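(* Let $M_0,M_1\in\mathbb{R}$ and $l,k\in\{0,\ldots,n-1\}$ be given. Suppose that for $j=0,1$ the problem $(P_{n,k}^{M_j})$ has a unique solution, and let $g_{n,k}[M_j]$ be its Green's function. Then the following identities hold for all $t,s\in I$ if $l<n-1$, and for all $t,s\in I$ with $t\neq s$ if $l=n-1$: $$\frac{\partial^l}{\partial t^l}g_{n,k}[M_1](t,s)=\frac{\partial^l}{\partial t^l}g_{n,k}[M_0](t,s)+(M_0-M_1)\int_a^b \frac{\partial^l}{\partial t^l}g_{n,k}[M_0](t,r)\,\frac{\partial^k}{\partial t^k}g_{n,k}[M_1](r,s)\,dr$$ and $$\frac{\partial^l}{\partial t^l}g_{n,k}[M_1](t,s)=\frac{\partial^l}{\partial t^l}g_{n,k}[M_0](t,s)+(M_0-M_1)\int_a^b \frac{\partial^l}{\partial t^l}g_{n,k}[M_1](t,r)\,\frac{\partial^k}{\partial t^k}g_{n,k}[M_0](r,s)\,dr .$$ Moreover, for all $k\in\{0,\ldots,n-1\}$ and all $t,s\in I$ with $t\ne s$: $$\frac{\partial^n}{\partial t^n}g_{n,k}[M_1](t,s)=\frac{\partial^n}{\partial t^n}g_{n,k}[M_0](t,s)+(M_0-M_1)\int_a^b \frac{\partial^n}{\partial t^n}g_{n,k}[M_0](t,r)\,\frac{\partial^k}{\partial t^k}g_{n,k}[M_1](r,s)\,dr+(M_0-M_1)\frac{\partial^k}{\partial t^k}g_{n,k}[M_1](t,s)$$ and $$\frac{\partial^n}{\partial t^n}g_{n,k}[M_1](t,s)=\frac{\partial^n}{\partial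 t^n}g_{n,k}[M_0](t,s)+(M_0-M_1)\int_a^b \frac{\partial^n}{\partial t^n}g_{n,k}[M_1](t,r)\,\frac{\partial^k}{\partial t^k}g_{n,k}[M_0](r,s)\,dr+(M_0-M_1)\frac{\partial^k}{\partial t^k}g_{n,k}[M_0](t,s).$$
   Context: Let $I=[a,b]$, $k\in\{0,\ldots,n-1\}$, $M\in\mathbb{R}$. Problem $(P_{n,k}^M)$ is: find $u\in C^n(I)$ with $T_{n,k}[M]u(t)=\sigma(t)$, $t\in I$, and $B_i(u)=0$, $i=1,\ldots,n$, where $T_{n,k}[M]u(t)=L_nu(t)+M\,u^{(k)}(t)$, $L_nu(t)=u^{(n)}(t)+a_1(t)u^{(n-1)}(t)+\cdots+a_n(t)u(t)$, $B_i(u)=\sum_{j=0}^{n-1}\bigl(\alpha^i_ju^{(j)}(a)+\beta^i_ju^{(j)}(b)\bigr)$, with real constants $\alpha^i_j,\beta^i_j$ and $\sigma,a_1,\ldots,a_n\in C(I)$. "$(P_{n,k}^M)$ has a unique solution" means that it has exactly one solution for every $\sigma\in C(I)$; this is equivalent to the homogeneous problem ($\sigma=0$) having only the trivial solution. The Green's function of $(P_{n,k}^M)$ is $g_{n,k}[M]\in C^{n-2}(I\times I)\cap C^n((I\times I)\setminus\{(t,t):t\in I\})$ which is, for each fixed $s\in(a,b)$, the unique solution of $T_{n,k}[M](g_{n,k}[M](t,s))=0$ for $t\in I\setminus\{s\}$, $B_i(g_{n,k}[M](\cdot,s))=0$, $i=1,\ldots,n$, and which satisfies: for each $t\in(a,b)$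 the following lateral limits exist, are finite, and fulfil, with $h=\frac{\partial^{n-1}}{\partial t^{n-1}}g_{n,k}[M]$, $h(t^-,t)=h(t,t^+)$, $h(t,t^-)=h(t^+,t)$ and $h(t^+,t)-h(t^-,t)=h(t,t^-)-h(t,t^+)=1$, where $h(t^{\pm},t)=\lim_{r\to t^\pm}h(r,t)$ and $h(t,t^\pm)=\lim_{r\to t^\pm}h(t,r)$. If $(P_{n,k}^M)$ has a unique solution, that solution is $u(t)=\int_a^b g_{n,k}[M](t,s)\sigma(s)\,ds$. $\frac{\partial^m}{\partial t^m}g_{n,k}[M](r,s)$ denotes the $m$-th partial derivative with respect to the first variable, evaluated at $(r,s)$. *)

theory Defs
  imports "HOL-Analysis.Analysis"
begin

text \<open>
  Derivatives are taken within the interval \<open>I\<close>, i.e. they are one-sided at its end points. As the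
  value at \<open>t\<close> only depends on the function near \<open>t\<close>, a singularity of \<open>f\<close> at
  some \<open>s\<close> does not affect \<open>iter_deriv I m f t\<close> for \<open>t \<noteq> s\<close>.
\<close>

definition iter_deriv :: "real set \<Rightarrow> nat \<Rightarrow> (real \<Rightarrow> real) \<Rightarrow> real \<Rightarrow> real" where
  "iter_deriv I m f = ((\<lambda>u t. vector_derivative u (at t within I)) ^^ m) f"

definition C_on :: "nat \<Rightarrow> real set \<Rightarrow> (real \<Rightarrow> real) \<Rightarrow> bool" where
  "C_on m I u \<longleftrightarrow>
     (\<forall>j<m. iter_deriv I j u differentiable_on I) \<and>
     (\<forall>j\<le>m. continuous_on I (iter_deriv I j u))"

text \<open>The \<open>m\<close>-th partial derivative with respect to the first variable.\<close>

definition pderiv1 :: "real set \<Rightarrow> nat \<Rightarrow> (real \<Rightarrow> real \<Rightarrow> real) \<Rightarrow> real \<Rightarrow> real \<Rightarrow> real" where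
  "pderiv1 I m g t s = iter_deriv I m (\<lambda>r. g r s) t"

text \<open>
  The regularity class \<open>C\<^sup>m(S)\<close>, \<open>S \<subseteq> I \<times> I\<close>, of a Green's function: the
  \<open>t\<close>-derivatives up to order \<open>m\<close> exist on \<open>S\<close> and are jointly continuous there.
  Mixed and \<open>s\<close>-derivatives are not required: when the coefficients of the operator are merely
  continuous, the Green's function in general does not have them (already for \<open>n = 2\<close> the second
  \<open>s\<close>-derivative need not exist unless \<open>a\<^sub>1\<close> is differentiable).
\<close>

definition C1st_on :: "nat \<Rightarrow> real set \<Rightarrow> (real \<times> real) set \<Rightarrow> (real \<Rightarrow> real \<Rightarrow> real) \<Rightarrow> bool" where
  "C1st_on m I S g \<longleftrightarrow>
     (\<forall>j<m. \<forall>(t, s)\<in>S. (\<lambda>r. pderiv1 I j g r s) differentiable (at t within I)) \<and>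
     (\<forall>j\<le>m. continuous_on S (\<lambda>(t, s). pderiv1 I j g t s))"

text \<open>\<open>c i\<close> is the coefficient \<open>a\<^sub>i\<close>, for \<open>i = 1, \<dots>, n\<close>.\<close>

definition L_op :: "real set \<Rightarrow> nat \<Rightarrow> (nat \<Rightarrow> real \<Rightarrow> real) \<Rightarrow> (real \<Rightarrow> real) \<Rightarrow> real \<Rightarrow> real" where
  "L_op I n c u t = iter_deriv I n u t + (\<Sum>i=1..n. c i t * iter_deriv I (n - i) u t)"

definition T_op ::
  "real set \<Rightarrow> nat \<Rightarrow> nat \<Rightarrow> (nat \<Rightarrow> real \<Rightarrow> real) \<Rightarrow> real \<Rightarrow> (real \<Rightarrow> real) \<Rightarrow> real \<Rightarrow> real" where
  "T_op I n k c M u t = L_op I n c u t + M * iter_deriv I k u t"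

definition B_op ::
  "real \<Rightarrow> real \<Rightarrow> nat \<Rightarrow> (nat \<Rightarrow> nat \<Rightarrow> real) \<Rightarrow> (nat \<Rightarrow> nat \<Rightarrow> real) \<Rightarrow> nat \<Rightarrow> (real \<Rightarrow> real) \<Rightarrow> real" where
  "B_op a b n \<alpha> \<beta> i u =
     (\<Sum>j<n. \<alpha> i j * iter_deriv {a..b} j u a + \<beta> i j * iter_deriv {a..b} j u b)"

definition is_solution ::
  "real \<Rightarrow> real \<Rightarrow> nat \<Rightarrow> nat \<Rightarrow> (nat \<Rightarrow> real \<Rightarrow> real) \<Rightarrow> (nat \<Rightarrow> nat \<Rightarrow> real) \<Rightarrow> (nat \<Rightarrow> nat \<Rightarrow> real) \<Rightarrow>
   real \<Rightarrow> (real \<Rightarrow> real) \<Rightarrow> (real \<Rightarrow> real) \<Rightarrow> bool" where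
  "is_solution a b n k c \<alpha> \<beta> M \<sigma> u \<longleftrightarrow>
     C_on n {a..b} u \<and>
     (\<forall>t\<in>{a..b}. T_op {a..b} n k c M u t = \<sigma> t) \<and>
     (\<forall>i\<in>{1..n}. B_op a b n \<alpha> \<beta> i u = 0)"

text \<open>Uniqueness is that of the restriction to \<open>[a, b]\<close>, as HOL functions are total.\<close>

definition has_unique_solution ::
  "real \<Rightarrow> real \<Rightarrow> nat \<Rightarrow> nat \<Rightarrow> (nat \<Rightarrow> real \<Rightarrow> real) \<Rightarrow> (nat \<Rightarrow> nat \<Rightarrow> real) \<Rightarrow> (nat \<Rightarrow> nat \<Rightarrow> real) \<Rightarrow>
   real \<Rightarrow> bool" where
  "has_unique_solution a b n k c \<alpha> \<beta> M \<longleftrightarrow>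
     (\<forall>\<sigma>. continuous_on {a..b} \<sigma> \<longrightarrow>
        (\<exists>u. is_solution a b n k c \<alpha> \<beta> M \<sigma> u \<and>
             (\<forall>v. is_solution a b n k c \<alpha> \<beta> M \<sigma> v \<longrightarrow> (\<forall>t\<in>{a..b}. v t = u t))))"

text \<open>
  For \<open>n = 1\<close> the class \<open>C\<^sup>n\<^sup>-\<^sup>2(I \<times> I)\<close> imposes no condition (truncated subtraction would
  wrongly give continuity across the diagonal). In the last clause \<open>p = h(t\<^sup>+, t) = h(t, t\<^sup>-)\<close> and
  \<open>q = h(t\<^sup>-, t) = h(t, t\<^sup>+)\<close>, where \<open>h\<close> is the \<open>t\<close>-derivative of order
  \<open>n - 1\<close>. When the problem has a unique solution, these conditions determine \<open>g\<close> on
  \<open>I \<times> I\<close> (off the diagonal, if \<open>n = 1\<close>).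
\<close>

definition is_green_function ::
  "real \<Rightarrow> real \<Rightarrow> nat \<Rightarrow> nat \<Rightarrow> (nat \<Rightarrow> real \<Rightarrow> real) \<Rightarrow> (nat \<Rightarrow> nat \<Rightarrow> real) \<Rightarrow> (nat \<Rightarrow> nat \<Rightarrow> real) \<Rightarrow>
   real \<Rightarrow> (real \<Rightarrow> real \<Rightarrow> real) \<Rightarrow> bool" where
  "is_green_function a b n k c \<alpha> \<beta> M g \<longleftrightarrow>
     (2 \<le> n \<longrightarrow> C1st_on (n - 2) {a..b} ({a..b} \<times> {a..b}) g) \<and>
     C1st_on n {a..b} ({a..b} \<times> {a..b} - {(t, t) | t. t \<in> {a..b}}) g \<and>
     (\<forall>s\<in>{a<..<b}.
        (\<forall>t\<in>{a..b} - {s}. T_op {a..b} n k c M (\<lambda>r. g r s) t = 0) \<and>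
        (\<forall>i\<in>{1..n}. B_op a b n \<alpha> \<beta> i (\<lambda>r. g r s) = 0)) \<and>
     (\<forall>t\<in>{a<..<b}. \<exists>p q.
        ((\<lambda>r. pderiv1 {a..b} (n - 1) g r t) \<longlongrightarrow> p) (at_right t) \<and>
        ((\<lambda>r. pderiv1 {a..b} (n - 1) g r t) \<longlongrightarrow> q) (at_left t) \<and>
        ((\<lambda>r. pderiv1 {a..b} (n - 1) g t r) \<longlongrightarrow> p) (at_left t) \<and>
        ((\<lambda>r. pderiv1 {a..b} (n - 1) g t r) \<longlongrightarrow> q) (at_right t) \<and>
        p - q = 1)"

end

theory Submission
  imports Defs
begin

text \<open>
  For fixed \<open>s\<close> in the open interval, the difference \<open>w = g1(\<cdot>, s) - g0(\<cdot>, s)\<close> has no jump left in its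
  derivative of order \<open>n - 1\<close>, satisfies the boundary conditions, and solves
  \<open>T[M0] w = (M0 - M1) \<sigma>\<close> with \<open>\<sigma> = \<partial>\<^sup>k g1(\<cdot>, s)\<close>. So does \<open>(M0 - M1)\<close> times the potential
  \<open>V t = \<integral> g0(t, r) \<sigma> r dr\<close>, and unique solvability for \<open>M0\<close> makes the two equal. This gives the identities
  with \<open>g0\<close> under the integral at order \<open>l\<close>; exchanging the two problems gives the others.

  Three points need care. First, for \<open>k = n - 1\<close> the right-hand side \<open>\<sigma>\<close> jumps at \<open>s\<close>, so \<open>w\<close> is not of class
  \<open>C\<^sup>n\<close> and unique solvability, which concerns continuous right-hand sides, cannot be applied to \<open>w\<close> and \<open>V\<close>
  separately. It applies to \<open>w - (M0 - M1) V\<close>, a solution of the homogeneous equation off \<open>s\<close>. Therefore all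
  functions are handled as chains \<open>Y 0, \<dots>, Y n\<close> in which \<open>Y j\<close> is a primitive of \<open>Y (j + 1)\<close>; such a relation
  does not see single points. A chain that solves the homogeneous problem off one point vanishes
  (\<open>derivative_chain_eq_zero\<close>).

  Second, the derivatives of \<open>V\<close> are not found by differentiating under the integral, where the diagonal
  singularity would interfere, but by integrating: for \<open>j < n\<close> the increments of \<open>\<partial>\<^sup>j g0(\<cdot>, r)\<close> are integrals of
  \<open>\<partial>\<^sup>j\<^sup>+\<^sup>1 g0(\<cdot>, r)\<close>, plus the unit jump when \<open>j = n - 1\<close>, and Fubini's theorem moves this to \<open>V\<close>
  (\<open>potential_chain\<close>). The jump is what produces the additional term \<open>\<sigma>\<close> at order \<open>n\<close>.

  Third, Fubini's theorem and dominated convergence require \<open>\<partial>\<^sup>j g\<close> to be bounded off the diagonal, whereas the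
  definition of a Green's function only gives continuity there. The bound comes from a Gronwall
  estimate for the differential equation on either side of \<open>s\<close>, transported across \<open>s\<close> by the jump
  condition (\<open>green_function_bounded\<close>). Dominated convergence then carries the identities from interior
  \<open>s \<noteq> t\<close> to the end points and, for \<open>l < n - 1\<close>, to the diagonal (\<open>green_function_perturbation\<close>).
\<close>

section \<open>Real integrals\<close>

lemma bounded_measurable_integrable_on:
  fixes f :: "real \<Rightarrow> real"
  assumes [measurable]: "f \<in> borel_measurable borel" and bd: "\<And>x. \<bar>f x\<bar> \<le> C"
  shows "set_integrable lborel {u..v} f" and "f integrable_on {u..v}"
proof -
  show *: "set_integrable lborel {u..v} f"
    unfolding set_integrable_def
    by (rule integrableI_bounded_set_indicator[where B = C]) (use bd in \<open>auto simp: emeasure_lborel_Icc_eq\<close>)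
  show "f integrable_on {u..v}"
    by (rule set_borel_integral_eq_integral(1)[OF *])
qed

text \<open>
  Fubini's theorem for gauge integrals, obtained from the Lebesgue version on a bounded rectangle.
\<close>

lemma integral_swap_bounded_measurable:
  fixes F :: "real \<Rightarrow> real \<Rightarrow> real"
  assumes meas: "(\<lambda>(x, y). F x y) \<in> borel_measurable borel" and bd: "\<And>x y. \<bar>F x y\<bar> \<le> C"
  shows "integral {p..q} (\<lambda>x. integral {u..v} (F x)) = integral {u..v} (\<lambda>y. integral {p..q} (\<lambda>x. F x y))"
    and "(\<lambda>x. integral {u..v} (F x)) integrable_on {p..q}"
proof -
  define f where "f x y = indicator ({p..q} \<times> {u..v}) (x, y) *\<^sub>R F x y" for x y
  have [measurable]: "(\<lambda>(x, y). F x y) \<in> borel_measurable (borel \<Otimes>\<^sub>M borel)"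
    using meas by (simp add: borel_prod)
  have sec1: "F x \<in> borel_measurable borel" for x
    by measurable
  have sec2: "(\<lambda>x. F x y) \<in> borel_measurable borel" for y
    by measurable
  have "emeasure (lborel \<Otimes>\<^sub>M lborel) ({p..q} \<times> {u..v}) < \<infinity>"
    by (subst lborel.emeasure_pair_measure_Times)
       (auto simp: emeasure_lborel_Icc_eq ennreal_mult_less_top)
  then have "integrable (lborel \<Otimes>\<^sub>M lborel) (\<lambda>z. indicator ({p..q} \<times> {u..v}) z *\<^sub>R (case z of (x, y) \<Rightarrow> F x y))"
    by (intro integrableI_bounded_set_indicator[where B = C]) (use bd in \<open>auto\<close>)
  then have int: "integrable (lborel \<Otimes>\<^sub>M lborel) (case_prod f)"
    by (rule Bochner_Integration.integrable_cong[THEN iffD1, rotated 2]) (auto simp: f_def)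
  have inner1: "(\<integral>y. f x y \<partial>lborel) = indicator {p..q} x *\<^sub>R integral {u..v} (F x)" for x
  proof -
    have "(\<integral>y. f x y \<partial>lborel) = (\<integral>y. indicator {p..q} x *\<^sub>R (indicator {u..v} y *\<^sub>R F x y) \<partial>lborel)"
      by (rule Bochner_Integration.integral_cong) (auto simp: f_def indicator_def)
    also have "\<dots> = indicator {p..q} x *\<^sub>R (LINT y:{u..v}|lborel. F x y)"
      by (simp add: set_lebesgue_integral_def)
    also have "(LINT y:{u..v}|lborel. F x y) = integral {u..v} (F x)"
      using set_borel_integral_eq_integral(2)[OF bounded_measurable_integrable_on(1)[OF sec1 bd]]
      by simp
    finally show ?thesis .
  qed
  have inner2: "(\<integral>x. f x y \<partial>lborel) = indicator {u..v} y *\<^sub>R integral {p..q} (\<lambda>x. F x y)" for y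
  proof -
    have "(\<integral>x. f x y \<partial>lborel) = (\<integral>x. indicator {u..v} y *\<^sub>R (indicator {p..q} x *\<^sub>R F x y) \<partial>lborel)"
      by (rule Bochner_Integration.integral_cong) (auto simp: f_def indicator_def)
    also have "\<dots> = indicator {u..v} y *\<^sub>R (LINT x:{p..q}|lborel. F x y)"
      by (simp add: set_lebesgue_integral_def)
    also have "(LINT x:{p..q}|lborel. F x y) = integral {p..q} (\<lambda>x. F x y)"
      using set_borel_integral_eq_integral(2)[OF bounded_measurable_integrable_on(1)[OF sec2 bd]]
      by simp
    finally show ?thesis .
  qed
  have set1: "set_integrable lborel {p..q} (\<lambda>x. integral {u..v} (F x))"
    using lborel_pair.integrable_fst[OF int] by (simp add: inner1 set_integrable_def)
  have set2: "set_integrable lborel {u..v} (\<lambda>y. integral {p..q} (\<lambda>x. F x y))"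
    using lborel_pair.integrable_snd[OF int] by (simp add: inner2 set_integrable_def)
  show "(\<lambda>x. integral {u..v} (F x)) integrable_on {p..q}"
    by (rule set_borel_integral_eq_integral(1)[OF set1])
  show "integral {p..q} (\<lambda>x. integral {u..v} (F x)) = integral {u..v} (\<lambda>y. integral {p..q} (\<lambda>x. F x y))"
    using lborel_pair.Fubini_integral[OF int]
    unfolding inner1 inner2 set_borel_integral_eq_integral(2)[OF set1, symmetric]
      set_borel_integral_eq_integral(2)[OF set2, symmetric]
    by (simp add: set_lebesgue_integral_def)
qed

text \<open>
  Lowering \<open>f\<close> by the jump \<open>J\<close> to the right of \<open>s\<close> makes it continuous, and the fundamental theorem of calculus
  tolerates the one point where the derivative is unknown.
\<close>

lemma has_integral_derivative_jump:
  fixes f f' :: "real \<Rightarrow> real"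
  assumes der: "\<And>t. t \<in> {p..q} - {s} \<Longrightarrow> (f has_vector_derivative f' t) (at t within {p..q})"
    and left: "(f \<longlongrightarrow> L) (at_left s)" and right: "(f \<longlongrightarrow> L + J) (at_right s)"
    and "p \<le> q" "p \<noteq> s" "q \<noteq> s"
  shows "(f' has_integral f q - f p - (if p < s \<and> s < q then J else 0)) {p..q}"
proof -
  define h where "h t = (if t = s then L else if t < s then f t else f t - J)" for t
  have h_der: "(h has_vector_derivative f' t) (at t within {p..q})" if t: "t \<in> {p..q} - {s}" for t
  proof -
    define d where "d = (if t < s then 0 else J)"
    have "((\<lambda>t. f t - d) has_vector_derivative f' t) (at t within {p..q})"
      using has_vector_derivative_diff_const[of f d "f' t"] der[OF t] by simp
    then show ?thesis
      by (rule has_vector_derivative_transform_within[where d = "\<bar>t - s\<bar>"])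
         (use t in \<open>auto simp: h_def d_def dist_real_def split: if_splits\<close>)
  qed
  have "(h \<longlongrightarrow> L) (at_left s)"
    using left by (rule Lim_transform_eventually) (auto simp: h_def eventually_at_filter)
  moreover have "(h \<longlongrightarrow> L) (at_right s)"
  proof -
    have "((\<lambda>t. f t - J) \<longlongrightarrow> L + J - J) (at_right s)"
      by (intro tendsto_intros right)
    then have "((\<lambda>t. f t - J) \<longlongrightarrow> L) (at_right s)" by simp
    then show ?thesis
      by (rule Lim_transform_eventually) (auto simp: h_def eventually_at_filter)
  qed
  ultimately have "isCont h s"
    by (simp add: isCont_def filterlim_split_at h_def)
  then have cont: "continuous_on {p..q} h"
    unfolding continuous_on_eq_continuous_within
    by (metis DiffI continuous_at_imp_continuous_at_within h_der has_vector_derivative_continuous singletonD)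
  have "(f' has_integral h q - h p) {p..q}"
  proof (rule fundamental_theorem_of_calculus_interior_strong[of "{s}"])
    show "(h has_vector_derivative f' x) (at x)" if "x \<in> {p<..<q} - {s}" for x
      using h_der[of x] that by (auto simp: at_within_Icc_at)
  qed (use cont \<open>p \<le> q\<close> in auto)
  then show ?thesis
    using assms(4-6) by (auto simp: h_def algebra_simps split: if_splits)
qed

section \<open>Growth of solutions of linear differential equations\<close>

text \<open>
  By the bound on the last entry, \<open>E\<close> satisfies \<open>\<bar>E'\<bar> \<le> K * E\<close>, so that \<open>E t * exp (- K * t)\<close> decreases and
  \<open>E t * exp (K * t)\<close> increases. Both directions are needed: a Green's function is controlled at \<open>a\<close> on the left of
  its singularity and at \<open>b\<close> on the right.
\<close>

lemma square_sum_gronwall: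
  fixes y :: "nat \<Rightarrow> real \<Rightarrow> real" and n :: nat and A p q :: real
  defines "E \<equiv> \<lambda>t. \<Sum>j<n. (y j t)\<^sup>2"
  assumes der: "\<And>j t. j < n \<Longrightarrow> t \<in> {p..q} \<Longrightarrow> (y j has_vector_derivative y (Suc j) t) (at t within {p..q})"
    and bd: "\<And>t. t \<in> {p..q} \<Longrightarrow> \<bar>y n t\<bar> \<le> A * (\<Sum>j<n. \<bar>y j t\<bar>)" and "0 \<le> A"
    and "p \<le> q"
  defines "K \<equiv> 2 * (1 + real n * A) * real n"
  shows "E q \<le> exp (K * (q - p)) * E p" and "E p \<le> exp (K * (q - p)) * E q"
proof -
  define E' where "E' t = (\<Sum>j<n. 2 * (y j t * y (Suc j) t))" for t
  have prod_le: "\<bar>y i t\<bar> * \<bar>y j t\<bar> \<le> E t" if "i < n" "j < n" for i j t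
  proof -
    have "(y i t)\<^sup>2 \<le> E t" "(y j t)\<^sup>2 \<le> E t"
      unfolding E_def using that by (auto intro!: member_le_sum)
    moreover have "2 * (\<bar>y i t\<bar> * \<bar>y j t\<bar>) \<le> \<bar>y i t\<bar>\<^sup>2 + \<bar>y j t\<bar>\<^sup>2"
      using sum_squares_bound[of "\<bar>y i t\<bar>" "\<bar>y j t\<bar>"] by (simp add: mult.assoc)
    ultimately show ?thesis by simp
  qed
  have E_nonneg: "0 \<le> E t" for t
    unfolding E_def by (intro sum_nonneg) auto
  have E'_le: "\<bar>E' t\<bar> \<le> K * E t" if t: "t \<in> {p..q}" for t
  proof -
    have "\<bar>y j t\<bar> * \<bar>y (Suc j) t\<bar> \<le> (1 + real n * A) * E t" if j: "j < n" for j
    proof (cases "Suc j < n")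
      case True
      have "0 \<le> real n * A * E t" using \<open>0 \<le> A\<close> E_nonneg by simp
      with prod_le[OF j True, of t] show ?thesis by (simp add: algebra_simps)
    next
      case False
      then have [simp]: "Suc j = n" using j by simp
      have "\<bar>y j t\<bar> * \<bar>y n t\<bar> \<le> \<bar>y j t\<bar> * (A * (\<Sum>i<n. \<bar>y i t\<bar>))"
        by (intro mult_left_mono bd t) auto
      also have "\<dots> = A * (\<Sum>i<n. \<bar>y j t\<bar> * \<bar>y i t\<bar>)"
        by (simp add: sum_distrib_left mult_ac)
      also have "\<dots> \<le> A * (\<Sum>i<n. E t)"
        using \<open>0 \<le> A\<close> j by (intro mult_left_mono sum_mono prod_le) auto
      also have "\<dots> \<le> (1 + real n * A) * E t"
        using E_nonneg[of t] by (simp add: algebra_simps)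
      finally show ?thesis by simp
    qed
    then have "\<bar>E' t\<bar> \<le> (\<Sum>j<n. 2 * ((1 + real n * A) * E t))"
      unfolding E'_def by (intro order.trans[OF sum_abs] sum_mono) (auto simp: abs_mult)
    also have "\<dots> = K * E t" by (simp add: K_def)
    finally show ?thesis .
  qed
  have E_der: "(E has_vector_derivative E' t) (at t within {p..q})" if "t \<in> {p..q}" for t
  proof -
    have "((\<lambda>t. \<Sum>j<n. y j t * y j t) has_vector_derivative
        (\<Sum>j<n. y j t * y (Suc j) t + y (Suc j) t * y j t)) (at t within {p..q})"
      using that by (intro has_vector_derivative_sum has_vector_derivative_mult der) auto
    then show ?thesis
      by (simp add: E_def E'_def power2_eq_square mult.commute)
  qed
  have E_cont: "continuous_on {p..q} E"
    unfolding continuous_on_eq_continuous_within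
    using E_der has_vector_derivative_continuous by blast
  have E_deriv: "(E has_real_derivative E' t) (at t)" if "p < t" "t < q" for t
    using E_der[of t] that by (auto simp: at_within_Icc_at has_real_derivative_iff_has_vector_derivative)
  have "E q * exp (-K * q) \<le> E p * exp (-K * p)"
  proof (rule DERIV_nonpos_imp_decreasing_open[OF \<open>p \<le> q\<close>])
    fix t assume t: "p < t" "t < q"
    have "((\<lambda>t. E t * exp (-K * t)) has_real_derivative (E' t - K * E t) * exp (-K * t)) (at t)"
      by (rule derivative_eq_intros E_deriv t refl | simp)+ (simp add: algebra_simps)
    moreover have "(E' t - K * E t) * exp (-K * t) \<le> 0"
      using E'_le[of t] t by (intro mult_nonpos_nonneg) auto
    ultimately show "\<exists>d. ((\<lambda>t. E t * exp (-K * t)) has_real_derivative d) (at t) \<and> d \<le> 0" by blast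
  qed (intro continuous_intros E_cont)
  then have "E q * exp (-K * q) * exp (K * q) \<le> E p * exp (-K * p) * exp (K * q)"
    by (rule mult_right_mono) simp
  then show "E q \<le> exp (K * (q - p)) * E p"
    by (simp add: mult.assoc mult.commute algebra_simps flip: exp_add)
  have "E p * exp (K * p) \<le> E q * exp (K * q)"
  proof (rule DERIV_nonneg_imp_increasing_open[OF \<open>p \<le> q\<close>])
    fix t assume t: "p < t" "t < q"
    have "((\<lambda>t. E t * exp (K * t)) has_real_derivative (E' t + K * E t) * exp (K * t)) (at t)"
      by (rule derivative_eq_intros E_deriv t refl | simp)+ (simp add: algebra_simps)
    moreover have "(E' t + K * E t) * exp (K * t) \<ge> 0"
      using E'_le[of t] t by (intro mult_nonneg_nonneg) auto
    ultimately show "\<exists>d. ((\<lambda>t. E t * exp (K * t)) has_real_derivative d) (at t) \<and> 0 \<le> d" by blast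
  qed (intro continuous_intros E_cont)
  then have "E p * exp (K * p) * exp (-K * p) \<le> E q * exp (K * q) * exp (-K * p)"
    by (rule mult_right_mono) simp
  then show "E p \<le> exp (K * (q - p)) * E q"
    by (simp add: mult.assoc mult.commute algebra_simps flip: exp_add)
qed

section \<open>Chains of primitives and the homogeneous problem\<close>

lemma iter_deriv_chain:
  assumes "a < b"
    and chain: "\<And>j t. j < n \<Longrightarrow> t \<in> {a..b} \<Longrightarrow> (Z j has_vector_derivative Z (Suc j) t) (at t within {a..b})"
  shows "j \<le> n \<Longrightarrow> t \<in> {a..b} \<Longrightarrow> iter_deriv {a..b} j (Z 0) t = Z j t"
    and "j < n \<Longrightarrow> t \<in> {a..b} \<Longrightarrow>
      (iter_deriv {a..b} j (Z 0) has_vector_derivative Z (Suc j) t) (at t within {a..b})"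
proof -
  have eq: "j \<le> n \<Longrightarrow> t \<in> {a..b} \<Longrightarrow> iter_deriv {a..b} j (Z 0) t = Z j t" for j t
  proof (induction j arbitrary: t)
    case 0
    then show ?case by (simp add: iter_deriv_def)
  next
    case (Suc j)
    have "(iter_deriv {a..b} j (Z 0) has_vector_derivative Z (Suc j) t) (at t within {a..b})"
      by (rule has_vector_derivative_transform[OF _ _ chain[of j t]]) (use Suc in auto)
    then show ?case
      using vector_derivative_within_closed_interval[OF \<open>a < b\<close>] Suc.prems
      by (simp add: iter_deriv_def)
  qed
  then show "j \<le> n \<Longrightarrow> t \<in> {a..b} \<Longrightarrow> iter_deriv {a..b} j (Z 0) t = Z j t" .
  show "(iter_deriv {a..b} j (Z 0) has_vector_derivative Z (Suc j) t) (at t within {a..b})"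
    if "j < n" "t \<in> {a..b}"
    by (rule has_vector_derivative_transform[OF _ _ chain[of j t]]) (use eq that in auto)
qed

lemma derivative_chain_is_solution:
  fixes Z :: "nat \<Rightarrow> real \<Rightarrow> real"
  assumes "k < n" "a < b"
    and der: "\<And>j t. j < n \<Longrightarrow> t \<in> {a..b} \<Longrightarrow> (Z j has_vector_derivative Z (Suc j) t) (at t within {a..b})"
    and cont: "continuous_on {a..b} (Z n)"
    and ode: "\<And>t. t \<in> {a..b} \<Longrightarrow> Z n t + (\<Sum>i=1..n. c i t * Z (n - i) t) + M * Z k t = \<sigma> t"
    and bc: "\<And>i. i \<in> {1..n} \<Longrightarrow> (\<Sum>j<n. \<alpha> i j * Z j a + \<beta> i j * Z j b) = 0"
  shows "is_solution a b n k c \<alpha> \<beta> M \<sigma> (Z 0)"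
  unfolding is_solution_def
proof (intro conjI ballI)
  note iter = iter_deriv_chain[where Z = Z and n = n, OF \<open>a < b\<close> der]
  have Z_cont: "continuous_on {a..b} (Z j)" if "j \<le> n" for j
  proof (cases "j < n")
    case True
    then show ?thesis
      unfolding continuous_on_eq_continuous_within
      using der has_vector_derivative_continuous by blast
  next
    case False
    then show ?thesis using cont that by simp
  qed
  have "iter_deriv {a..b} j (Z 0) differentiable_on {a..b}" if "j < n" for j
    unfolding differentiable_on_def
    using iter(2)[OF _ _ that] differentiableI_vector by blast
  moreover have "continuous_on {a..b} (iter_deriv {a..b} j (Z 0))" if "j \<le> n" for j
    by (rule continuous_on_cong[THEN iffD2, OF refl _ Z_cont[OF that]]) (use iter(1) that in auto)
  ultimately show "C_on n {a..b} (Z 0)"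
    by (simp add: C_on_def)
  show "T_op {a..b} n k c M (Z 0) t = \<sigma> t" if "t \<in> {a..b}" for t
    using ode[OF that] iter(1)[OF _ _ _ that] \<open>k < n\<close> by (simp add: T_op_def L_op_def)
  show "B_op a b n \<alpha> \<beta> i (Z 0) = 0" if "i \<in> {1..n}" for i
    using bc[OF that] iter(1) \<open>a < b\<close> by (simp add: B_op_def)
qed

text \<open>
  The integral relations do not see the point \<open>s\<close>, so \<open>Y\<close> agrees off \<open>s\<close> with a chain \<open>Z\<close> of continuous functions;
  its top entry is defined by the differential equation and hence continuous as well. Thus \<open>Z 0\<close> is a
  classical solution of the homogeneous problem, and vanishes.
\<close>

lemma derivative_chain_eq_zero:
  fixes Y :: "nat \<Rightarrow> real \<Rightarrow> real"
  assumes "k < n" and s: "a < s" "s < b"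
    and c_cont: "\<And>i. i \<in> {1..n} \<Longrightarrow> continuous_on {a..b} (c i)"
    and unique: "has_unique_solution a b n k c \<alpha> \<beta> M"
    and chain: "\<And>j t. j < n \<Longrightarrow> t \<in> {a..b} - {s} \<Longrightarrow> (Y (Suc j) has_integral Y j t - Y j a) {a..t}"
    and ode: "\<And>t. t \<in> {a..b} - {s} \<Longrightarrow> Y n t + (\<Sum>i=1..n. c i t * Y (n - i) t) + M * Y k t = 0"
    and bc: "\<And>i. i \<in> {1..n} \<Longrightarrow> (\<Sum>j<n. \<alpha> i j * Y j a + \<beta> i j * Y j b) = 0"
    and "j \<le> n" "t \<in> {a..b} - {s}"
  shows "Y j t = 0"
proof -
  have "a < b" using s by simp
  define Z' where "Z' j t = Y j a + integral {a..t} (Y (Suc j))" for j t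
  define Z where "Z j t = (if j < n then Z' j t
    else - (\<Sum>i=1..n. c i t * Z' (n - i) t) - M * Z' k t)" for j t
  \<comment> \<open>Integrals are insensitive to \<open>s\<close>, so \<open>Z' j\<close> is continuous there no matter what \<open>Y j s\<close> is.\<close>
  have integrable: "Y (Suc j) integrable_on {a..b}" if "j < n" for j
    using chain[of j b] that s by (auto simp: integrable_on_def)
  have Z'_cont: "continuous_on {a..b} (Z' j)" if "j < n" for j
    unfolding Z'_def by (intro continuous_intros indefinite_integral_continuous_1 integrable that)
  have Z_cont: "continuous_on {a..b} (Z j)" for j
  proof (cases "j < n")
    case True
    then show ?thesis using Z'_cont[of j] by (simp add: Z_def)
  next
    case False
    then show ?thesis using \<open>k < n\<close>
      by (auto simp: Z_def intro!: continuous_intros Z'_cont c_cont)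
  qed
  have Z'_eq: "Z' j t = Y j t" if "j < n" "t \<in> {a..b} - {s}" for j t
    using chain[OF that] by (simp add: Z'_def integral_unique)
  have Z_eq: "Z j t = Y j t" if "j \<le> n" "t \<in> {a..b} - {s}" for j t
  proof (cases "j < n")
    case True
    then show ?thesis using Z'_eq that by (simp add: Z_def)
  next
    case False
    then have "j = n" using that by simp
    have "(\<Sum>i=1..n. c i t * Z' (n - i) t) = (\<Sum>i=1..n. c i t * Y (n - i) t)"
      by (intro sum.cong refl) (use Z'_eq that in auto)
    then show ?thesis
      using ode[OF that(2)] Z'_eq[OF \<open>k < n\<close> that(2)] \<open>j = n\<close> by (simp add: Z_def)
  qed
  have Z_der: "(Z j has_vector_derivative Z (Suc j) t) (at t within {a..b})"
    if "j < n" "t \<in> {a..b}" for j t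
  proof -
    have "integral {a..t} (Y (Suc j)) = integral {a..t} (Z (Suc j))" if "t \<in> {a..b}" for t
      by (rule integral_spike[of "{s}"]) (use Z_eq \<open>j < n\<close> that in auto)
    then have eq: "Z j t = Y j a + integral {a..t} (Z (Suc j))" if "t \<in> {a..b}" for t
      using that \<open>j < n\<close> by (simp add: Z_def Z'_def)
    have "((\<lambda>t. Y j a + integral {a..t} (Z (Suc j))) has_vector_derivative 0 + Z (Suc j) t) (at t within {a..b})"
      by (intro has_vector_derivative_add has_vector_derivative_const integral_has_vector_derivative Z_cont that)
    then show ?thesis
      by (intro has_vector_derivative_transform[OF \<open>t \<in> {a..b}\<close> eq]) auto
  qed
  have Z_ode: "Z n t + (\<Sum>i=1..n. c i t * Z (n - i) t) + M * Z k t = 0" for t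
  proof -
    have "(\<Sum>i=1..n. c i t * Z (n - i) t) = (\<Sum>i=1..n. c i t * Z' (n - i) t)"
      by (intro sum.cong refl) (auto simp: Z_def)
    then show ?thesis using \<open>k < n\<close> by (simp add: Z_def)
  qed
  have "is_solution a b n k c \<alpha> \<beta> M (\<lambda>_. 0) (Z 0)"
  proof (rule derivative_chain_is_solution[where Z = Z, OF \<open>k < n\<close> \<open>a < b\<close> Z_der Z_cont])
    show "(\<Sum>j<n. \<alpha> i j * Z j a + \<beta> i j * Z j b) = 0" if "i \<in> {1..n}" for i
      using bc[OF that] Z_eq s by simp
  qed (use Z_ode in auto)
  moreover have "is_solution a b n k c \<alpha> \<beta> M (\<lambda>_. 0) (\<lambda>_. 0)"
    by (rule derivative_chain_is_solution[where Z = "\<lambda>_ _. 0", OF \<open>k < n\<close> \<open>a < b\<close>]) auto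
  ultimately have Z0: "Z 0 t = 0" if "t \<in> {a..b}" for t
    using unique that unfolding has_unique_solution_def
    by (metis continuous_on_const)
  have "Z j t = 0" if "j \<le> n" "t \<in> {a..b}" for j t
    using that
  proof (induction j arbitrary: t)
    case 0
    then show ?case using Z0 by simp
  next
    case (Suc j)
    have "((\<lambda>_. 0) has_vector_derivative Z (Suc j) t) (at t within {a..b})"
      by (rule has_vector_derivative_transform[OF _ _ Z_der[of j t]]) (use Suc in auto)
    from vector_derivative_within_closed_interval[OF \<open>a < b\<close> _ this]
      vector_derivative_within_closed_interval[OF \<open>a < b\<close> _ has_vector_derivative_const]
    show ?case using Suc.prems by metis
  qed
  then show ?thesis using Z_eq assms by auto
qed

section \<open>Potentials of Green kernels\<close>

text \<open>
  What the proof uses of the derivatives \<open>\<partial>\<^sup>j g\<close> of a Green's function, in integrated form. The equations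
  \<open>ode\<close> and \<open>bc\<close> are demanded at all arguments because the kernels in question are set to zero where
  the derivatives of \<open>g\<close> do not obey them. In \<open>chain\<close> the term \<open>1\<close> is the jump of the derivative of order \<open>n - 1\<close>.
\<close>

locale green_kernel =
  fixes a b :: real and n k :: nat and c :: "nat \<Rightarrow> real \<Rightarrow> real" and \<alpha> \<beta> :: "nat \<Rightarrow> nat \<Rightarrow> real"
    and M :: real and G :: "nat \<Rightarrow> real \<Rightarrow> real \<Rightarrow> real"
  assumes order: "k < n"
    and measurable_kernel: "j \<le> n \<Longrightarrow> (\<lambda>(t, r). G j t r) \<in> borel_measurable borel"
    and bounded_kernel: "\<exists>C. \<forall>j\<le>n. \<forall>t r. \<bar>G j t r\<bar> \<le> C"
    and chain: "j < n \<Longrightarrow> r \<in> {a<..<b} \<Longrightarrow> t \<in> {a..b} - {r} \<Longrightarrow>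
      ((\<lambda>\<tau>. G (Suc j) \<tau> r) has_integral
        G j t r - G j a r - (if Suc j = n \<and> r < t then 1 else 0)) {a..t}"
    and ode: "G n t r + (\<Sum>i=1..n. c i t * G (n - i) t r) + M * G k t r = 0"
    and bc: "i \<in> {1..n} \<Longrightarrow> (\<Sum>j<n. \<alpha> i j * G j a r + \<beta> i j * G j b r) = 0"
begin

lemma section_measurable:
  assumes "j \<le> n"
  shows "(\<lambda>r. G j t r) \<in> borel_measurable borel" and "(\<lambda>t. G j t r) \<in> borel_measurable borel"
proof -
  have [measurable]: "(\<lambda>(t, r). G j t r) \<in> borel_measurable (borel \<Otimes>\<^sub>M borel)"
    using measurable_kernel[OF assms] by (simp add: borel_prod)
  show "(\<lambda>r. G j t r) \<in> borel_measurable borel" "(\<lambda>t. G j t r) \<in> borel_measurable borel"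
    by measurable
qed

definition potential :: "(real \<Rightarrow> real) \<Rightarrow> nat \<Rightarrow> real \<Rightarrow> real" where
  "potential \<sigma> j t = integral {a..b} (\<lambda>r. G j t r * \<sigma> r)"

context
  fixes \<sigma> :: "real \<Rightarrow> real" and S :: real
  assumes \<sigma>_measurable: "\<sigma> \<in> borel_measurable borel" and \<sigma>_bounded: "\<And>r. \<bar>\<sigma> r\<bar> \<le> S"
begin

lemma integrand_bounded:
  "\<exists>C. \<forall>j\<le>n. \<forall>t r r'. \<bar>G j t r * \<sigma> r'\<bar> \<le> C"
proof -
  obtain C where C: "\<And>j t r. j \<le> n \<Longrightarrow> \<bar>G j t r\<bar> \<le> C"
    using bounded_kernel by blast
  show ?thesis
  proof (intro exI[of _ "C * S"] allI impI)
    fix j t r r' assume "j \<le> n"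
    have "0 \<le> C" using C[OF \<open>j \<le> n\<close>, of t r] by linarith
    then show "\<bar>G j t r * \<sigma> r'\<bar> \<le> C * S"
      using C[OF \<open>j \<le> n\<close>, of t r] \<sigma>_bounded[of r'] unfolding abs_mult by (intro mult_mono) auto
  qed
qed

lemma potential_integrable:
  assumes "j \<le> n"
  shows "(\<lambda>r. G j t r * \<sigma> r) integrable_on {a..b}"
proof -
  obtain C where C: "\<And>j t r r'. j \<le> n \<Longrightarrow> \<bar>G j t r * \<sigma> r'\<bar> \<le> C"
    using integrand_bounded by blast
  note [measurable] = section_measurable(1)[OF assms] \<sigma>_measurable
  show ?thesis
    by (rule bounded_measurable_integrable_on(2)[of _ C]) (use C assms in auto)
qed

text \<open>
  Integrate the relation \<open>chain\<close> of the kernel against \<open>\<sigma>\<close> and exchange the two integrals. The unit jumps at the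
  points \<open>r < t\<close> add up to the integral of \<open>\<sigma>\<close> over \<open>{a..t}\<close>.
\<close>

lemma potential_chain:
  assumes "j < n" and t: "t \<in> {a..b}"
  shows "((\<lambda>\<tau>. potential \<sigma> (Suc j) \<tau> + (if Suc j = n then \<sigma> \<tau> else 0)) has_integral
    potential \<sigma> j t - potential \<sigma> j a) {a..t}"
proof -
  obtain C where C: "\<And>j t r r'. j \<le> n \<Longrightarrow> \<bar>G j t r * \<sigma> r'\<bar> \<le> C"
    using integrand_bounded by blast
  define e :: real where "e = (if Suc j = n then 1 else 0)"
  have "Suc j \<le> n" using assms by simp
  note [measurable] = \<sigma>_measurable
  have [measurable]: "(\<lambda>(t, r). G (Suc j) t r) \<in> borel_measurable (borel \<Otimes>\<^sub>M borel)"
    using measurable_kernel[OF \<open>Suc j \<le> n\<close>] by (simp add: borel_prod)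
  have "(\<lambda>(\<tau>, r). G (Suc j) \<tau> r * \<sigma> r) \<in> borel_measurable (borel \<Otimes>\<^sub>M borel)"
    by measurable
  then have F_meas: "(\<lambda>(\<tau>, r). G (Suc j) \<tau> r * \<sigma> r) \<in> borel_measurable borel"
    by (simp add: borel_prod)
  have "(\<lambda>(r, \<tau>). G (Suc j) \<tau> r * \<sigma> r) \<in> borel_measurable (borel \<Otimes>\<^sub>M borel)"
    by measurable
  then have F_meas': "(\<lambda>(r, \<tau>). G (Suc j) \<tau> r * \<sigma> r) \<in> borel_measurable borel"
    by (simp add: borel_prod)
  note swap = integral_swap_bounded_measurable[where F = "\<lambda>\<tau> r. G (Suc j) \<tau> r * \<sigma> r",
      OF F_meas C[rule_format, OF \<open>Suc j \<le> n\<close>], where p = a and q = t and u = a and v = b]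
  note swap' = integral_swap_bounded_measurable(2)[where F = "\<lambda>r \<tau>. G (Suc j) \<tau> r * \<sigma> r",
      OF F_meas' C[rule_format, OF \<open>Suc j \<le> n\<close>], where p = a and q = b and u = a and v = t]
  have \<sigma>_int: "\<sigma> integrable_on {u..v}" for u v
    by (rule bounded_measurable_integrable_on(2)[OF \<sigma>_measurable \<sigma>_bounded])
  have cut_has_int: "((\<lambda>r. if r \<in> {a..t} then \<sigma> r else 0) has_integral integral {a..t} \<sigma>) {a..b}"
  proof -
    have "(\<sigma> has_integral integral {a..t} \<sigma>) ({a..t} \<inter> {a..b})"
      using t \<sigma>_int[of a t] by (simp add: Int_absorb2 has_integral_integral)
    then show ?thesis by (simp only: has_integral_restrict_Int Int_commute)
  qed
  \<comment> \<open>The points \<open>a\<close>, \<open>t\<close> and \<open>b\<close>, where \<open>chain\<close> says nothing, form a null set.\<close>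
  have eq: "(G j t r - G j a r) * \<sigma> r
      = integral {a..t} (\<lambda>\<tau>. G (Suc j) \<tau> r * \<sigma> r) + e * (if r \<in> {a..t} then \<sigma> r else 0)"
    if r: "r \<in> {a..b} - {a, t, b}" for r
  proof -
    have "((\<lambda>\<tau>. G (Suc j) \<tau> r) has_integral
        G j t r - G j a r - (if Suc j = n \<and> r < t then 1 else 0)) {a..t}"
      using chain[of j r t] assms r by auto
    from has_integral_mult_left[OF this, of "\<sigma> r"]
    have "integral {a..t} (\<lambda>\<tau>. G (Suc j) \<tau> r * \<sigma> r)
        = (G j t r - G j a r - (if Suc j = n \<and> r < t then 1 else 0)) * \<sigma> r"
      by (rule integral_unique)
    then show ?thesis using r by (auto simp: e_def algebra_simps)
  qed
  have "potential \<sigma> j t - potential \<sigma> j a = integral {a..b} (\<lambda>r. G j t r * \<sigma> r - G j a r * \<sigma> r)"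
    unfolding potential_def using \<open>j < n\<close>
    by (intro integral_diff[symmetric] potential_integrable) auto
  also have "\<dots> = integral {a..b} (\<lambda>r. integral {a..t} (\<lambda>\<tau>. G (Suc j) \<tau> r * \<sigma> r)
      + e * (if r \<in> {a..t} then \<sigma> r else 0))"
    by (rule integral_spike[of "{a, t, b}"]) (use eq in \<open>auto simp: left_diff_distrib\<close>)
  also have "\<dots> = integral {a..b} (\<lambda>r. integral {a..t} (\<lambda>\<tau>. G (Suc j) \<tau> r * \<sigma> r)) + e * integral {a..t} \<sigma>"
  proof (rule integral_unique, intro has_integral_add has_integral_mult_right cut_has_int)
    show "((\<lambda>r. integral {a..t} (\<lambda>\<tau>. G (Suc j) \<tau> r * \<sigma> r)) has_integral
        integral {a..b} (\<lambda>r. integral {a..t} (\<lambda>\<tau>. G (Suc j) \<tau> r * \<sigma> r))) {a..b}"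
      by (rule integrable_integral[OF swap'])
  qed
  also have "integral {a..b} (\<lambda>r. integral {a..t} (\<lambda>\<tau>. G (Suc j) \<tau> r * \<sigma> r))
      = integral {a..t} (potential \<sigma> (Suc j))"
    using swap(1) by (simp add: potential_def[abs_def])
  finally have diff: "potential \<sigma> j t - potential \<sigma> j a
      = integral {a..t} (potential \<sigma> (Suc j)) + e * integral {a..t} \<sigma>" .
  have "((\<lambda>\<tau>. potential \<sigma> (Suc j) \<tau> + e * \<sigma> \<tau>) has_integral potential \<sigma> j t - potential \<sigma> j a) {a..t}"
    unfolding diff
    by (intro has_integral_add has_integral_mult_right integrable_integral \<sigma>_int)
       (use swap(2) in \<open>simp add: potential_def[abs_def]\<close>)
  then show ?thesis
    by (rule has_integral_eq[rotated]) (simp add: e_def)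
qed

lemma potential_ode:
  "potential \<sigma> n t + (\<Sum>i=1..n. c i t * potential \<sigma> (n - i) t) + M * potential \<sigma> k t = 0"
proof -
  have "((\<lambda>r. G n t r * \<sigma> r + (\<Sum>i=1..n. c i t * (G (n - i) t r * \<sigma> r)) + M * (G k t r * \<sigma> r)) has_integral
      potential \<sigma> n t + (\<Sum>i=1..n. c i t * potential \<sigma> (n - i) t) + M * potential \<sigma> k t) {a..b}"
    unfolding potential_def using order
    by (intro has_integral_add has_integral_mult_right has_integral_sum integrable_integral potential_integrable) auto
  moreover have "G n t r * \<sigma> r + (\<Sum>i=1..n. c i t * (G (n - i) t r * \<sigma> r)) + M * (G k t r * \<sigma> r) = 0"
    (is "?lhs = 0") for r
  proof -
    have "?lhs = (G n t r + (\<Sum>i=1..n. c i t * G (n - i) t r) + M * G k t r) * \<sigma> r"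
      by (simp add: distrib_right sum_distrib_right mult.assoc)
    then show ?thesis using ode[of t r] by simp
  qed
  ultimately show ?thesis
    using has_integral_unique has_integral_0 by fastforce
qed

lemma potential_bc:
  assumes "i \<in> {1..n}"
  shows "(\<Sum>j<n. \<alpha> i j * potential \<sigma> j a + \<beta> i j * potential \<sigma> j b) = 0"
proof -
  have "((\<lambda>r. \<Sum>j<n. \<alpha> i j * (G j a r * \<sigma> r) + \<beta> i j * (G j b r * \<sigma> r)) has_integral
      (\<Sum>j<n. \<alpha> i j * potential \<sigma> j a + \<beta> i j * potential \<sigma> j b)) {a..b}"
    unfolding potential_def
    by (intro has_integral_add has_integral_mult_right has_integral_sum integrable_integral potential_integrable) auto
  moreover have "(\<Sum>j<n. \<alpha> i j * (G j a r * \<sigma> r) + \<beta> i j * (G j b r * \<sigma> r)) = 0"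
    (is "?lhs = 0") for r
  proof -
    have "?lhs = (\<Sum>j<n. \<alpha> i j * G j a r + \<beta> i j * G j b r) * \<sigma> r"
      by (simp add: distrib_right sum_distrib_right mult.assoc)
    then show ?thesis by (simp add: bc[OF assms])
  qed
  ultimately show ?thesis
    using has_integral_unique has_integral_0 by fastforce
qed

end

end

text \<open>
  The chain \<open>Y\<close> of the difference of both sides solves the homogeneous problem for \<open>M0\<close> off \<open>s\<close>: the unit jumps of
  the two kernels at \<open>s\<close> cancel, and the terms \<open>(M0 - M1) * G1 k t s\<close>, which arise from writing the equation for
  \<open>M1\<close> with \<open>M0\<close>, cancel against the additional term of the potential at order \<open>n\<close>.
\<close>

lemma resolvent_identity:
  assumes "green_kernel a b n k c \<alpha> \<beta> M0 G0" and "green_kernel a b n k c \<alpha> \<beta> M1 G1"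
    and c_cont: "\<And>i. i \<in> {1..n} \<Longrightarrow> continuous_on {a..b} (c i)"
    and unique: "has_unique_solution a b n k c \<alpha> \<beta> M0"
    and s: "s \<in> {a<..<b}" and "l \<le> n" and t: "t \<in> {a..b} - {s}"
  shows "G1 l t s = G0 l t s + (M0 - M1) *
    (integral {a..b} (\<lambda>r. G0 l t r * G1 k r s) + (if l = n then G1 k t s else 0))"
proof -
  interpret K0: green_kernel a b n k c \<alpha> \<beta> M0 G0 by fact
  interpret K1: green_kernel a b n k c \<alpha> \<beta> M1 G1 by fact
  define \<sigma> where "\<sigma> r = G1 k r s" for r
  have "k \<le> n" using K0.order by simp
  obtain S where S: "\<And>r. \<bar>\<sigma> r\<bar> \<le> S"
    using K1.bounded_kernel \<open>k \<le> n\<close> unfolding \<sigma>_def by blast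
  have meas: "\<sigma> \<in> borel_measurable borel"
    unfolding \<sigma>_def[abs_def] by (rule K1.section_measurable(2)[OF \<open>k \<le> n\<close>])
  define V where "V = K0.potential \<sigma>"
  note V_chain = K0.potential_chain[OF meas S, folded V_def]
  note V_ode = K0.potential_ode[OF meas S, folded V_def]
  note V_bc = K0.potential_bc[OF meas S, folded V_def]
  define Y where "Y j t = G1 j t s - G0 j t s - (M0 - M1) * (V j t + (if j = n then \<sigma> t else 0))" for j t
  have "Y l t = 0"
  proof (rule derivative_chain_eq_zero[where Y = Y and s = s, OF K0.order _ _ c_cont unique])
    show "(Y (Suc j) has_integral Y j t - Y j a) {a..t}" if "j < n" "t \<in> {a..b} - {s}" for j t
    proof -
      have "(Y (Suc j) has_integral
         (G1 j t s - G1 j a s - (if Suc j = n \<and> s < t then 1 else 0))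
         - (G0 j t s - G0 j a s - (if Suc j = n \<and> s < t then 1 else 0))
         - (M0 - M1) * (V j t - V j a)) {a..t}"
        unfolding Y_def[abs_def]
        by (intro has_integral_diff has_integral_mult_right V_chain K0.chain K1.chain s that)
           (use that in auto)
      moreover have "(G1 j t s - G1 j a s - (if Suc j = n \<and> s < t then 1 else 0))
         - (G0 j t s - G0 j a s - (if Suc j = n \<and> s < t then 1 else 0))
         - (M0 - M1) * (V j t - V j a) = Y j t - Y j a"
        using that by (simp add: Y_def algebra_simps)
      ultimately show ?thesis by simp
    qed
    show "Y n t + (\<Sum>i=1..n. c i t * Y (n - i) t) + M0 * Y k t = 0" for t
    proof -
      have "(\<Sum>i=1..n. c i t * Y (n - i) t)
          = (\<Sum>i=1..n. c i t * G1 (n - i) t s - c i t * G0 (n - i) t s - (M0 - M1) * (c i t * V (n - i) t))"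
        by (intro sum.cong refl) (auto simp: Y_def algebra_simps)
      also have "\<dots> = (\<Sum>i=1..n. c i t * G1 (n - i) t s) - (\<Sum>i=1..n. c i t * G0 (n - i) t s)
          - (M0 - M1) * (\<Sum>i=1..n. c i t * V (n - i) t)"
        by (simp add: sum_subtractf sum_distrib_left)
      also have "(\<Sum>i=1..n. c i t * G1 (n - i) t s) = - G1 n t s - M1 * \<sigma> t"
        using K1.ode[of t s] by (simp add: \<sigma>_def)
      also have "(\<Sum>i=1..n. c i t * G0 (n - i) t s) = - G0 n t s - M0 * G0 k t s"
        using K0.ode[of t s] by simp
      also have "(\<Sum>i=1..n. c i t * V (n - i) t) = - V n t - M0 * V k t"
        using V_ode[of t] by simp
      finally show ?thesis
        using K0.order by (simp add: Y_def \<sigma>_def algebra_simps)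
    qed
    show "(\<Sum>j<n. \<alpha> i j * Y j a + \<beta> i j * Y j b) = 0" if "i \<in> {1..n}" for i
    proof -
      have "(\<Sum>j<n. \<alpha> i j * Y j a + \<beta> i j * Y j b)
        = (\<Sum>j<n. (\<alpha> i j * G1 j a s + \<beta> i j * G1 j b s) - (\<alpha> i j * G0 j a s + \<beta> i j * G0 j b s)
            - (M0 - M1) * (\<alpha> i j * V j a + \<beta> i j * V j b))"
        by (intro sum.cong refl) (auto simp: Y_def algebra_simps)
      also have "\<dots> = (\<Sum>j<n. \<alpha> i j * G1 j a s + \<beta> i j * G1 j b s)
            - (\<Sum>j<n. \<alpha> i j * G0 j a s + \<beta> i j * G0 j b s)
            - (M0 - M1) * (\<Sum>j<n. \<alpha> i j * V j a + \<beta> i j * V j b)"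
        by (simp only: sum_subtractf sum_distrib_left)
      also have "\<dots> = 0"
        using K0.bc[OF that] K1.bc[OF that] V_bc[OF that] by simp
      finally show ?thesis .
    qed
  qed (use s \<open>l \<le> n\<close> t in auto)
  then show ?thesis
    by (cases "l = n") (simp_all add: Y_def V_def K0.potential_def \<sigma>_def)
qed

section \<open>Uniform bounds off the diagonal\<close>

lemma finite_family_bounded:
  fixes f :: "'i \<Rightarrow> 'x::topological_space \<Rightarrow> real"
  assumes "finite J" "compact X" "\<And>j. j \<in> J \<Longrightarrow> continuous_on X (f j)"
  shows "\<exists>C\<ge>0. \<forall>j\<in>J. \<forall>x\<in>X. \<bar>f j x\<bar> \<le> C"
proof -
  have "bounded (\<Union>j\<in>J. f j ` X)"
    using assms by (intro bounded_UN ballI compact_imp_bounded compact_continuous_image)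
  then obtain C where "0 < C" "\<forall>y\<in>(\<Union>j\<in>J. f j ` X). norm y \<le> C"
    unfolding bounded_pos by blast
  then show ?thesis by (intro exI[of _ C]) auto
qed

lemma sum_reverse_index: "(\<Sum>i=1..n. f (n - i)) = (\<Sum>j<n. f j)" for f :: "nat \<Rightarrow> real"
  by (simp add: sum.atLeast1_atMost_eq sum.nat_diff_reindex)

text \<open>
  The factor is independent of \<open>u\<close> and \<open>v\<close>, in either order, which makes the bounds below uniform in the
  position of the singularity.
\<close>

lemma chain_bound_transport:
  fixes y :: "nat \<Rightarrow> real \<Rightarrow> real" and n :: nat and A a b u v C :: real
  assumes der: "\<And>j t. j < n \<Longrightarrow> t \<in> {min u v..max u v} \<Longrightarrow>
      (y j has_vector_derivative y (Suc j) t) (at t within {a..b})"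
    and bd: "\<And>t. t \<in> {min u v..max u v} \<Longrightarrow> \<bar>y n t\<bar> \<le> A * (\<Sum>j<n. \<bar>y j t\<bar>)" and "0 \<le> A"
    and uv: "u \<in> {a..b}" "v \<in> {a..b}"
    and u: "\<And>j. j < n \<Longrightarrow> \<bar>y j u\<bar> \<le> C" and "j < n"
  shows "\<bar>y j v\<bar> \<le> sqrt (exp (2 * (1 + real n * A) * real n * (b - a)) * real n) * C"
proof -
  define E where "E t = (\<Sum>j<n. (y j t)\<^sup>2)" for t
  define K where "K = 2 * (1 + real n * A) * real n"
  have "0 \<le> C" using u[OF \<open>j < n\<close>] by linarith
  have sub: "(y j has_vector_derivative y (Suc j) t) (at t within {min u v..max u v})"
    if "j < n" "t \<in> {min u v..max u v}" for j t
    by (rule has_vector_derivative_within_subset[OF der[OF that]]) (use uv in auto)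
  note gronwall = square_sum_gronwall[where y = y and n = n and p = "min u v" and q = "max u v",
      OF sub bd \<open>0 \<le> A\<close>, folded E_def K_def]
  have "E v \<le> exp (K * (max u v - min u v)) * E u"
    using gronwall by (cases "u \<le> v") (auto simp: min_def max_def)
  also have "\<dots> \<le> exp (K * (b - a)) * (real n * C\<^sup>2)"
  proof (intro mult_mono)
    have "0 \<le> K" using \<open>0 \<le> A\<close> by (simp add: K_def)
    then show "exp (K * (max u v - min u v)) \<le> exp (K * (b - a))"
      using uv by (auto intro!: mult_left_mono simp: min_def max_def)
    have "E u \<le> (\<Sum>j<n. C\<^sup>2)"
      unfolding E_def by (intro sum_mono) (use u \<open>0 \<le> C\<close> in \<open>simp add: abs_le_square_iff[symmetric]\<close>)
    then show "E u \<le> real n * C\<^sup>2" by simp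
  qed (auto simp: E_def sum_nonneg)
  finally have E_v: "E v \<le> exp (K * (b - a)) * real n * C\<^sup>2" by (simp add: mult_ac)
  have "(y j v)\<^sup>2 \<le> E v"
    unfolding E_def using \<open>j < n\<close> by (intro member_le_sum) auto
  with E_v have "sqrt ((y j v)\<^sup>2) \<le> sqrt (exp (K * (b - a)) * real n * C\<^sup>2)"
    by (intro real_sqrt_le_mono) simp
  then show ?thesis
    using \<open>0 \<le> C\<close> by (simp add: real_sqrt_mult K_def)
qed

text \<open>
  A bound at one end point spreads up to the singularity, passes to the one-sided limits there,
  changes by at most \<open>1\<close> across the jump, and spreads to the other end point from a point \<open>x\<close> beyond the
  singularity. The \<open>2\<close> in the result is this \<open>1\<close> plus a margin for replacing the limit by the value at \<open>x\<close>.
\<close>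

lemma jump_chain_bounded:
  fixes y :: "nat \<Rightarrow> real \<Rightarrow> real" and n :: nat and A a b s C :: real
  assumes s: "a < s" "s < b"
    and der: "\<And>j t. j < n \<Longrightarrow> t \<in> {a..b} - {s} \<Longrightarrow>
      (y j has_vector_derivative y (Suc j) t) (at t within {a..b})"
    and bd: "\<And>t. t \<in> {a..b} - {s} \<Longrightarrow> \<bar>y n t\<bar> \<le> A * (\<Sum>j<n. \<bar>y j t\<bar>)" and "0 \<le> A"
    and jump: "\<And>j. j < n \<Longrightarrow> \<exists>L J. (y j \<longlongrightarrow> L) (at_left s) \<and> (y j \<longlongrightarrow> L + J) (at_right s) \<and> \<bar>J\<bar> \<le> 1"
    and C: "(\<forall>j<n. \<bar>y j a\<bar> \<le> C) \<or> (\<forall>j<n. \<bar>y j b\<bar> \<le> C)"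
    and j: "j < n" and t: "t \<in> {a..b} - {s}"
  defines "\<rho> \<equiv> sqrt (exp (2 * (1 + real n * A) * real n * (b - a)) * real n)"
  shows "\<bar>y j t\<bar> \<le> \<rho> * C + \<rho> * (\<rho> * C + 2)"
proof -
  have transport: "\<bar>y j v\<bar> \<le> \<rho> * B"
    if "j < n" "u \<in> {a..b}" "v \<in> {a..b}" "s \<notin> {min u v..max u v}" "\<And>j. j < n \<Longrightarrow> \<bar>y j u\<bar> \<le> B" for j u v B
    unfolding \<rho>_def
    by (rule chain_bound_transport[where u = u]) (use that \<open>0 \<le> A\<close> in \<open>auto intro!: der bd\<close>)
  have "0 \<le> C" using C j by force
  have "0 \<le> \<rho>" by (simp add: \<rho>_def)
  have nonneg: "0 \<le> \<rho> * C" "0 \<le> \<rho> * (\<rho> * C + 2)" using \<open>0 \<le> C\<close> \<open>0 \<le> \<rho>\<close> by auto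
  from C show ?thesis
  proof
    assume Ca: "\<forall>j<n. \<bar>y j a\<bar> \<le> C"
    have left: "\<bar>y j t\<bar> \<le> \<rho> * C" if "j < n" "a \<le> t" "t < s" for j t
      using that s Ca by (intro transport[of j a t]) auto
    show ?thesis
    proof (cases "t < s")
      case True
      then show ?thesis using left[OF j, of t] t nonneg by simp
    next
      case False
      then have "s < t" using t by auto
      have "eventually (\<lambda>x. \<bar>y j x\<bar> \<le> \<rho> * C + 2) (at_right s)" if j: "j < n" for j
      proof -
        obtain L J where L: "(y j \<longlongrightarrow> L) (at_left s)" "(y j \<longlongrightarrow> L + J) (at_right s)" "\<bar>J\<bar> \<le> 1"
          using jump[OF j] by blast
        have "\<bar>L\<bar> \<le> \<rho> * C"
          by (rule tendsto_upperbound[OF tendsto_rabs[OF L(1)]])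
             (use left[OF j] s(1) in \<open>auto intro: eventually_at_leftI[of a]\<close>)
        then have "\<bar>L + J\<bar> < \<rho> * C + 2" using L(3) by linarith
        then have "eventually (\<lambda>x. \<bar>y j x\<bar> < \<rho> * C + 2) (at_right s)"
          by (rule order_tendstoD(2)[OF tendsto_rabs[OF L(2)]])
        then show ?thesis by eventually_elim simp
      qed
      then have "eventually (\<lambda>x. \<forall>j\<in>{..<n}. \<bar>y j x\<bar> \<le> \<rho> * C + 2) (at_right s)"
        by (intro eventually_ball_finite) auto
      moreover have "eventually (\<lambda>x. x \<in> {s<..<t}) (at_right s)"
        using \<open>s < t\<close> by (rule eventually_at_right_real)
      ultimately obtain x where x: "\<forall>j<n. \<bar>y j x\<bar> \<le> \<rho> * C + 2" "s < x" "x < t"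
        using eventually_happens[OF eventually_conj] by fastforce
      have "\<bar>y j t\<bar> \<le> \<rho> * (\<rho> * C + 2)"
        using x t s j by (intro transport[of j x t]) auto
      then show ?thesis using nonneg by linarith
    qed
  next
    assume Cb: "\<forall>j<n. \<bar>y j b\<bar> \<le> C"
    have right: "\<bar>y j t\<bar> \<le> \<rho> * C" if "j < n" "s < t" "t \<le> b" for j t
      using that s Cb by (intro transport[of j b t]) auto
    show ?thesis
    proof (cases "s < t")
      case True
      then show ?thesis using right[OF j, of t] t nonneg by simp
    next
      case False
      then have "t < s" using t by auto
      have "eventually (\<lambda>x. \<bar>y j x\<bar> \<le> \<rho> * C + 2) (at_left s)" if j: "j < n" for j
      proof -
        obtain L J where L: "(y j \<longlongrightarrow> L) (at_left s)" "(y j \<longlongrightarrow> L + J) (at_right s)" "\<bar>J\<bar> \<le> 1"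
          using jump[OF j] by blast
        have "\<bar>L + J\<bar> \<le> \<rho> * C"
          by (rule tendsto_upperbound[OF tendsto_rabs[OF L(2)]])
             (use right[OF j] s(2) in \<open>auto intro: eventually_at_rightI[of _ b]\<close>)
        then have "\<bar>L\<bar> < \<rho> * C + 2" using L(3) by linarith
        then have "eventually (\<lambda>x. \<bar>y j x\<bar> < \<rho> * C + 2) (at_left s)"
          by (rule order_tendstoD(2)[OF tendsto_rabs[OF L(1)]])
        then show ?thesis by eventually_elim simp
      qed
      then have "eventually (\<lambda>x. \<forall>j\<in>{..<n}. \<bar>y j x\<bar> \<le> \<rho> * C + 2) (at_left s)"
        by (intro eventually_ball_finite) auto
      moreover have "eventually (\<lambda>x. x \<in> {t<..<s}) (at_left s)"
        using \<open>t < s\<close> by (rule eventually_at_left_real)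
      ultimately obtain x where x: "\<forall>j<n. \<bar>y j x\<bar> \<le> \<rho> * C + 2" "t < x" "x < s"
        using eventually_happens[OF eventually_conj] by fastforce
      have "\<bar>y j t\<bar> \<le> \<rho> * (\<rho> * C + 2)"
        using x t s j by (intro transport[of j x t]) auto
      then show ?thesis using nonneg by linarith
    qed
  qed
qed

section \<open>Derivatives of Green's functions\<close>

lemma pderiv1_Suc: "pderiv1 I (Suc j) g t s = vector_derivative (\<lambda>r. pderiv1 I j g r s) (at t within I)"
  by (simp add: pderiv1_def iter_deriv_def)

context
  fixes a b M :: real and n k :: nat and c :: "nat \<Rightarrow> real \<Rightarrow> real" and \<alpha> \<beta> :: "nat \<Rightarrow> nat \<Rightarrow> real"
    and g :: "real \<Rightarrow> real \<Rightarrow> real"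
  assumes "a < b" "k < n" and green: "is_green_function a b n k c \<alpha> \<beta> M g"
begin

lemma green_function_derivative:
  assumes "j < n" "t \<in> {a..b}" "s \<in> {a..b}" "t \<noteq> s"
  shows "((\<lambda>r. pderiv1 {a..b} j g r s) has_vector_derivative pderiv1 {a..b} (Suc j) g t s) (at t within {a..b})"
proof -
  have "C1st_on n {a..b} ({a..b} \<times> {a..b} - {(t, t) | t. t \<in> {a..b}}) g"
    using green by (simp add: is_green_function_def)
  then have "\<forall>(t, s)\<in>{a..b} \<times> {a..b} - {(t, t) | t. t \<in> {a..b}}.
      (\<lambda>r. pderiv1 {a..b} j g r s) differentiable (at t within {a..b})"
    using assms(1) unfolding C1st_on_def by blast
  then have "(\<lambda>r. pderiv1 {a..b} j g r s) differentiable (at t within {a..b})"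
    using assms by auto
  then show ?thesis
    by (simp add: pderiv1_Suc flip: vector_derivative_works)
qed

lemma green_function_continuous:
  assumes "j \<le> n" and "\<And>t s. (t, s) \<in> S \<Longrightarrow> t \<in> {a..b} \<and> s \<in> {a..b} \<and> (t \<noteq> s \<or> Suc j < n)"
  shows "continuous_on S (\<lambda>(t, s). pderiv1 {a..b} j g t s)"
proof (cases "Suc j < n")
  case True
  then have "C1st_on (n - 2) {a..b} ({a..b} \<times> {a..b}) g"
    using green by (simp add: is_green_function_def)
  then have "continuous_on ({a..b} \<times> {a..b}) (\<lambda>(t, s). pderiv1 {a..b} j g t s)"
    using True unfolding C1st_on_def by simp
  then show ?thesis
    by (rule continuous_on_subset) (use assms(2) in auto)
next
  case False
  have "C1st_on n {a..b} ({a..b} \<times> {a..b} - {(t, t) | t. t \<in> {a..b}}) g"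
    using green by (simp add: is_green_function_def)
  then have "continuous_on ({a..b} \<times> {a..b} - {(t, t) | t. t \<in> {a..b}}) (\<lambda>(t, s). pderiv1 {a..b} j g t s)"
    using \<open>j \<le> n\<close> unfolding C1st_on_def by simp
  then show ?thesis
    by (rule continuous_on_subset) (use assms(2) False in auto)
qed

lemma green_function_continuous_snd:
  assumes "j \<le> n" "t \<in> {a..b}" and "\<And>s. s \<in> S \<Longrightarrow> s \<in> {a..b} \<and> (t \<noteq> s \<or> Suc j < n)"
  shows "continuous_on S (\<lambda>s. pderiv1 {a..b} j g t s)"
proof -
  have "continuous_on (Pair t ` S) (\<lambda>(t, s). pderiv1 {a..b} j g t s)"
    by (rule green_function_continuous) (use assms in auto)
  then have "continuous_on S ((\<lambda>(t, s). pderiv1 {a..b} j g t s) \<circ> Pair t)"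
    by (rule continuous_on_compose[rotated]) (intro continuous_intros)
  then show ?thesis by (simp add: comp_def)
qed

text \<open>
  Below order \<open>n - 1\<close> this is continuity across the diagonal, at order \<open>n - 1\<close> it is the jump condition.
\<close>

lemma green_function_one_sided_limits:
  assumes "j < n" and s: "s \<in> {a<..<b}"
  shows "\<exists>L. ((\<lambda>r. pderiv1 {a..b} j g r s) \<longlongrightarrow> L) (at_left s) \<and>
    ((\<lambda>r. pderiv1 {a..b} j g r s) \<longlongrightarrow> L + (if Suc j = n then 1 else 0)) (at_right s)"
proof (cases "Suc j = n")
  case True
  have "n - 1 = j" using True by simp
  have "\<forall>t\<in>{a<..<b}. \<exists>p q.
        ((\<lambda>r. pderiv1 {a..b} (n - 1) g r t) \<longlongrightarrow> p) (at_right t) \<and>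
        ((\<lambda>r. pderiv1 {a..b} (n - 1) g r t) \<longlongrightarrow> q) (at_left t) \<and>
        ((\<lambda>r. pderiv1 {a..b} (n - 1) g t r) \<longlongrightarrow> p) (at_left t) \<and>
        ((\<lambda>r. pderiv1 {a..b} (n - 1) g t r) \<longlongrightarrow> q) (at_right t) \<and>
        p - q = 1"
    using green unfolding is_green_function_def by (elim conjE)
  then obtain p q where pq: "((\<lambda>r. pderiv1 {a..b} (n - 1) g r s) \<longlongrightarrow> p) (at_right s)"
    "((\<lambda>r. pderiv1 {a..b} (n - 1) g r s) \<longlongrightarrow> q) (at_left s)" "p - q = 1"
    using s by (elim ballE exE conjE) auto
  then have "p = q + 1" by simp
  with pq show ?thesis using True \<open>n - 1 = j\<close> by auto
next
  case False
  then have "continuous_on ((\<lambda>t. (t, s)) ` {a..b}) (\<lambda>(t, s). pderiv1 {a..b} j g t s)"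
    by (intro green_function_continuous) (use assms in auto)
  then have "continuous_on {a..b} ((\<lambda>(t, s). pderiv1 {a..b} j g t s) \<circ> (\<lambda>t. (t, s)))"
    by (rule continuous_on_compose[rotated]) (intro continuous_intros)
  then have "continuous_on {a..b} (\<lambda>t. pderiv1 {a..b} j g t s)"
    by (simp add: comp_def)
  then have "isCont (\<lambda>t. pderiv1 {a..b} j g t s) s"
    by (rule continuous_on_interior) (use s in auto)
  then show ?thesis
    using False by (auto simp: isCont_def filterlim_at_split)
qed

lemma green_function_ode:
  assumes "t \<in> {a..b}" "s \<in> {a<..<b}" "t \<noteq> s"
  shows "pderiv1 {a..b} n g t s + (\<Sum>i=1..n. c i t * pderiv1 {a..b} (n - i) g t s)
    + M * pderiv1 {a..b} k g t s = 0"
proof -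
  have "\<forall>s\<in>{a<..<b}. (\<forall>t\<in>{a..b} - {s}. T_op {a..b} n k c M (\<lambda>r. g r s) t = 0) \<and>
      (\<forall>i\<in>{1..n}. B_op a b n \<alpha> \<beta> i (\<lambda>r. g r s) = 0)"
    using green unfolding is_green_function_def by (elim conjE)
  then have "T_op {a..b} n k c M (\<lambda>r. g r s) t = 0" using assms by blast
  then show ?thesis unfolding T_op_def L_op_def pderiv1_def .
qed

lemma green_function_bc:
  assumes "i \<in> {1..n}" "s \<in> {a<..<b}"
  shows "(\<Sum>j<n. \<alpha> i j * pderiv1 {a..b} j g a s + \<beta> i j * pderiv1 {a..b} j g b s) = 0"
proof -
  have "\<forall>s\<in>{a<..<b}. (\<forall>t\<in>{a..b} - {s}. T_op {a..b} n k c M (\<lambda>r. g r s) t = 0) \<and>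
      (\<forall>i\<in>{1..n}. B_op a b n \<alpha> \<beta> i (\<lambda>r. g r s) = 0)"
    using green unfolding is_green_function_def by (elim conjE)
  then have "B_op a b n \<alpha> \<beta> i (\<lambda>r. g r s) = 0" using assms by blast
  then show ?thesis unfolding B_op_def pderiv1_def .
qed

text \<open>
  As \<open>s\<close> tends to \<open>a\<close>, nothing is known in advance about the values at \<open>(a, s)\<close>, but those at \<open>(b, s)\<close> stay in a compact set
  away from the diagonal; near \<open>b\<close> it is the other way round. So the estimate starts at the end point which is
  farther from \<open>s\<close>.
\<close>

lemma green_function_bounded:
  assumes c_cont: "\<And>i. i \<in> {1..n} \<Longrightarrow> continuous_on {a..b} (c i)"
  shows "\<exists>C\<ge>0. \<forall>j\<le>n. \<forall>t\<in>{a..b}. \<forall>s\<in>{a<..<b}. t \<noteq> s \<longrightarrow> \<bar>pderiv1 {a..b} j g t s\<bar> \<le> C"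
proof -
  define D where "D = (\<lambda>j t s. pderiv1 {a..b} j g t s)"
  obtain A0 where A0: "0 \<le> A0" "\<And>i t. i \<in> {1..n} \<Longrightarrow> t \<in> {a..b} \<Longrightarrow> \<bar>c i t\<bar> \<le> A0"
    using finite_family_bounded[of "{1..n}" "{a..b}" c] c_cont by blast
  define A where "A = A0 + \<bar>M\<bar>"
  have "0 \<le> A" using A0 by (simp add: A_def)
  have top_bound: "\<bar>D n t s\<bar> \<le> A * (\<Sum>j<n. \<bar>D j t s\<bar>)" if "t \<in> {a..b}" "s \<in> {a<..<b}" "t \<noteq> s" for t s
  proof -
    have "D n t s = - ((\<Sum>i=1..n. c i t * D (n - i) t s) + M * D k t s)"
      using green_function_ode[OF that] by (simp add: D_def)
    also have "\<bar>\<dots>\<bar> \<le> (\<Sum>i=1..n. \<bar>c i t * D (n - i) t s\<bar>) + \<bar>M * D k t s\<bar>"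
      unfolding abs_minus_cancel by (intro order.trans[OF abs_triangle_ineq] add_mono sum_abs) auto
    also have "\<dots> \<le> (\<Sum>i=1..n. A0 * \<bar>D (n - i) t s\<bar>) + \<bar>M\<bar> * (\<Sum>j<n. \<bar>D j t s\<bar>)"
      unfolding abs_mult using \<open>k < n\<close> that
      by (intro add_mono sum_mono mult_right_mono mult_left_mono A0 member_le_sum) auto
    also have "\<dots> = A * (\<Sum>j<n. \<bar>D j t s\<bar>)"
      using sum_reverse_index[of "\<lambda>j. \<bar>D j t s\<bar>" n]
      by (simp add: A_def distrib_right flip: sum_distrib_left)
    finally show ?thesis .
  qed
  define m where "m = (a + b) / 2"
  have m: "a < m" "m < b" using \<open>a < b\<close> by (auto simp: m_def)
  have "\<exists>C\<ge>0. \<forall>j\<in>{..<n}. \<forall>s\<in>{m..b}. \<bar>D j a s\<bar> \<le> C"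
    unfolding D_def by (intro finite_family_bounded green_function_continuous_snd) (use m in auto)
  then obtain Ca where Ca: "\<And>j s. j < n \<Longrightarrow> s \<in> {m..b} \<Longrightarrow> \<bar>D j a s\<bar> \<le> Ca"
    by blast
  have "\<exists>C\<ge>0. \<forall>j\<in>{..<n}. \<forall>s\<in>{a..m}. \<bar>D j b s\<bar> \<le> C"
    unfolding D_def by (intro finite_family_bounded green_function_continuous_snd) (use m in auto)
  then obtain Cb where Cb: "\<And>j s. j < n \<Longrightarrow> s \<in> {a..m} \<Longrightarrow> \<bar>D j b s\<bar> \<le> Cb"
    by blast
  define C where "C = max Ca Cb"
  define \<rho> where "\<rho> = sqrt (exp (2 * (1 + real n * A) * real n * (b - a)) * real n)"
  define R where "R = \<rho> * C + \<rho> * (\<rho> * C + 2)"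
  have lower: "\<bar>D j t s\<bar> \<le> R" if "j < n" "t \<in> {a..b}" "s \<in> {a<..<b}" "t \<noteq> s" for j t s
    unfolding R_def \<rho>_def
  proof (rule jump_chain_bounded[where y = "\<lambda>j t. D j t s" and s = s])
    show "\<exists>L J. ((\<lambda>t. D j t s) \<longlongrightarrow> L) (at_left s) \<and> ((\<lambda>t. D j t s) \<longlongrightarrow> L + J) (at_right s) \<and> \<bar>J\<bar> \<le> 1"
      if "j < n" for j
      using green_function_one_sided_limits[OF that \<open>s \<in> {a<..<b}\<close>] unfolding D_def by fastforce
    show "(\<forall>j<n. \<bar>D j a s\<bar> \<le> C) \<or> (\<forall>j<n. \<bar>D j b s\<bar> \<le> C)"
    proof (cases "m \<le> s")
      case True
      then have "\<forall>j<n. \<bar>D j a s\<bar> \<le> C" using Ca that unfolding C_def by (intro allI impI max.coboundedI1) auto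
      then show ?thesis ..
    next
      case False
      then have "\<forall>j<n. \<bar>D j b s\<bar> \<le> C" using Cb that unfolding C_def by (intro allI impI max.coboundedI2) auto
      then show ?thesis ..
    qed
    show "((\<lambda>t. D j t s) has_vector_derivative D (Suc j) t s) (at t within {a..b})"
      if "j < n" "t \<in> {a..b} - {s}" for j t
      unfolding D_def by (rule green_function_derivative) (use that \<open>s \<in> {a<..<b}\<close> in auto)
    show "\<bar>D n t s\<bar> \<le> A * (\<Sum>j<n. \<bar>D j t s\<bar>)" if "t \<in> {a..b} - {s}" for t
      using top_bound that \<open>s \<in> {a<..<b}\<close> by auto
  qed (use that \<open>0 \<le> A\<close> in auto)
  have "\<bar>D j t s\<bar> \<le> max 0 (max R (A * (real n * R)))"
    if "j \<le> n" "t \<in> {a..b}" "s \<in> {a<..<b}" "t \<noteq> s" for j t s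
  proof (cases "j = n")
    case True
    have "(\<Sum>j<n. \<bar>D j t s\<bar>) \<le> (\<Sum>j<n. R)"
      using that by (intro sum_mono lower) auto
    then have "A * (\<Sum>j<n. \<bar>D j t s\<bar>) \<le> A * (real n * R)"
      using \<open>0 \<le> A\<close> by (intro mult_left_mono) auto
    then show ?thesis using top_bound[of t s] that True by auto
  next
    case False
    then show ?thesis using lower[of j t s] that by auto
  qed
  then show ?thesis
    unfolding D_def by (intro exI[of _ "max 0 (max R (A * (real n * R)))"]) auto
qed

end

text \<open>
  Setting the kernel to zero on the diagonal removes the meaningless values of the derivatives of order at
  least \<open>n - 1\<close>. The sections at \<open>r = a\<close> and \<open>r = b\<close> are removed too, since the differential equation and the boundary
  conditions are only imposed for interior \<open>r\<close>. Both changes are invisible to integrals over \<open>r\<close>.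
\<close>

definition off_diagonal_kernel :: "real \<Rightarrow> real \<Rightarrow> (real \<Rightarrow> real \<Rightarrow> real) \<Rightarrow> nat \<Rightarrow> real \<Rightarrow> real \<Rightarrow> real" where
  "off_diagonal_kernel a b g j t r =
    (if t \<in> {a..b} \<and> r \<in> {a<..<b} \<and> t \<noteq> r then pderiv1 {a..b} j g t r else 0)"

lemma green_function_imp_kernel:
  assumes "a < b" "k < n" and green: "is_green_function a b n k c \<alpha> \<beta> M g"
    and c_cont: "\<And>i. i \<in> {1..n} \<Longrightarrow> continuous_on {a..b} (c i)"
  shows "green_kernel a b n k c \<alpha> \<beta> M (off_diagonal_kernel a b g)"
proof
  note basic = \<open>a < b\<close> \<open>k < n\<close> green
  show "k < n" by fact
  show "(\<lambda>(t, r). off_diagonal_kernel a b g j t r) \<in> borel_measurable borel" if "j \<le> n" for j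
  proof -
    define A where "A = {p. fst p \<in> {a..b} \<and> snd p \<in> {a<..<b} \<and> fst p \<noteq> snd p}"
    have "A = {a..b} \<times> UNIV \<inter> UNIV \<times> {a<..<b} \<inter> {p. fst p \<noteq> snd p}"
      by (auto simp: A_def)
    moreover have "{a..b} \<times> (UNIV :: real set) \<in> sets borel"
      by (intro borel_closed closed_Times) auto
    moreover have "(UNIV :: real set) \<times> {a<..<b} \<in> sets borel"
      by (intro borel_open open_Times) auto
    moreover have "{p :: real \<times> real. fst p \<noteq> snd p} \<in> sets borel"
      by (intro borel_open open_Collect_neq continuous_intros)
    ultimately have "A \<in> sets borel" by auto
    moreover have "continuous_on A (\<lambda>(t, s). pderiv1 {a..b} j g t s)"
      by (rule green_function_continuous[OF basic that]) (auto simp: A_def)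
    ultimately have "(\<lambda>p. if p \<in> A then (\<lambda>(t, s). pderiv1 {a..b} j g t s) p else 0) \<in> borel_measurable borel"
      by (rule borel_measurable_continuous_on_if) (rule continuous_on_const)
    also have "(\<lambda>p. if p \<in> A then (\<lambda>(t, s). pderiv1 {a..b} j g t s) p else 0)
        = (\<lambda>(t, r). off_diagonal_kernel a b g j t r)"
      by (auto simp: A_def off_diagonal_kernel_def fun_eq_iff)
    finally show ?thesis .
  qed
  show "\<exists>C. \<forall>j\<le>n. \<forall>t r. \<bar>off_diagonal_kernel a b g j t r\<bar> \<le> C"
  proof -
    obtain C where "0 \<le> C" "\<forall>j\<le>n. \<forall>t\<in>{a..b}. \<forall>s\<in>{a<..<b}. t \<noteq> s \<longrightarrow> \<bar>pderiv1 {a..b} j g t s\<bar> \<le> C"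
      using green_function_bounded[OF basic c_cont] by blast
    then show ?thesis
      by (intro exI[of _ C]) (auto simp: off_diagonal_kernel_def)
  qed
  show "((\<lambda>\<tau>. off_diagonal_kernel a b g (Suc j) \<tau> r) has_integral
      off_diagonal_kernel a b g j t r - off_diagonal_kernel a b g j a r
      - (if Suc j = n \<and> r < t then 1 else 0)) {a..t}"
    if j: "j < n" and r: "r \<in> {a<..<b}" and t: "t \<in> {a..b} - {r}" for j r t
  proof -
    define J :: real where "J = (if Suc j = n then 1 else 0)"
    obtain L where L: "((\<lambda>\<tau>. pderiv1 {a..b} j g \<tau> r) \<longlongrightarrow> L) (at_left r)"
      "((\<lambda>\<tau>. pderiv1 {a..b} j g \<tau> r) \<longlongrightarrow> L + J) (at_right r)"
      using green_function_one_sided_limits[OF basic j r] by (auto simp: J_def)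
    have "((\<lambda>\<tau>. pderiv1 {a..b} (Suc j) g \<tau> r) has_integral
        pderiv1 {a..b} j g t r - pderiv1 {a..b} j g a r - (if a < r \<and> r < t then J else 0)) {a..t}"
    proof (rule has_integral_derivative_jump[OF _ L])
      show "((\<lambda>\<tau>. pderiv1 {a..b} j g \<tau> r) has_vector_derivative pderiv1 {a..b} (Suc j) g \<tau> r)
          (at \<tau> within {a..t})" if "\<tau> \<in> {a..t} - {r}" for \<tau>
        by (rule has_vector_derivative_within_subset[OF green_function_derivative[OF basic j]])
           (use that r t in auto)
    qed (use r t in auto)
    then have "((\<lambda>\<tau>. off_diagonal_kernel a b g (Suc j) \<tau> r) has_integral
        pderiv1 {a..b} j g t r - pderiv1 {a..b} j g a r - (if a < r \<and> r < t then J else 0)) {a..t}"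
      by (rule has_integral_spike_finite[of "{r}", rotated 2])
         (use r t in \<open>auto simp: off_diagonal_kernel_def\<close>)
    moreover have "pderiv1 {a..b} j g t r - pderiv1 {a..b} j g a r - (if a < r \<and> r < t then J else 0)
      = off_diagonal_kernel a b g j t r - off_diagonal_kernel a b g j a r
      - (if Suc j = n \<and> r < t then 1 else 0)"
      using r t \<open>a < b\<close> by (auto simp: off_diagonal_kernel_def J_def)
    ultimately show ?thesis by simp
  qed
  show "off_diagonal_kernel a b g n t r + (\<Sum>i=1..n. c i t * off_diagonal_kernel a b g (n - i) t r)
      + M * off_diagonal_kernel a b g k t r = 0" for t r
    using green_function_ode[OF basic, of t r] by (auto simp: off_diagonal_kernel_def)
  show "(\<Sum>j<n. \<alpha> i j * off_diagonal_kernel a b g j a r + \<beta> i j * off_diagonal_kernel a b g j b r) = 0"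
    if "i \<in> {1..n}" for i r
    using green_function_bc[OF basic that, of r] \<open>a < b\<close>
    by (cases "r \<in> {a<..<b}") (auto simp: off_diagonal_kernel_def)
qed

section \<open>Comparison of the two Green's functions\<close>

text \<open>
  Both kinds of identity in one: the last summand is present at order \<open>n\<close> only. The resolvent identity gives
  the case of interior \<open>s \<noteq> t\<close>. The general case is its limit along points \<open>x m\<close> of this kind that tend to \<open>s\<close>, with \<open>t\<close>
  fixed; the integrals converge because the kernels are bounded.
\<close>

lemma green_function_perturbation:
  assumes "a < b" "k < n"
    and c_cont: "\<And>i. i \<in> {1..n} \<Longrightarrow> continuous_on {a..b} (c i)"
    and unique: "has_unique_solution a b n k c \<alpha> \<beta> M0"
    and g0: "is_green_function a b n k c \<alpha> \<beta> M0 g0"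
    and g1: "is_green_function a b n k c \<alpha> \<beta> M1 g1"
    and "l \<le> n" and t: "t \<in> {a..b}" and s: "s \<in> {a..b}" and ts: "t \<noteq> s \<or> Suc l < n"
  shows "pderiv1 {a..b} l g1 t s = pderiv1 {a..b} l g0 t s + (M0 - M1) *
    (integral {a..b} (\<lambda>r. pderiv1 {a..b} l g0 t r * pderiv1 {a..b} k g1 r s)
      + (if l = n then pderiv1 {a..b} k g1 t s else 0))"
proof -
  define G0 where "G0 = off_diagonal_kernel a b g0"
  define G1 where "G1 = off_diagonal_kernel a b g1"
  interpret K0: green_kernel a b n k c \<alpha> \<beta> M0 G0
    unfolding G0_def by (rule green_function_imp_kernel) fact+
  interpret K1: green_kernel a b n k c \<alpha> \<beta> M1 G1
    unfolding G1_def by (rule green_function_imp_kernel) fact+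
  have "s islimpt {a<..<b}"
  proof -
    consider "s = a" | "s = b" | "s \<in> interior {a<..<b}" using s by force
    then show ?thesis
      using \<open>a < b\<close> islimpt_greaterThanLessThan1 islimpt_greaterThanLessThan2 interior_limit_point
      by cases auto
  qed
  then have "s islimpt ({a<..<b} - {t})"
    by (metis insert_Diff_single islimpt_insert)
  then obtain x where x: "\<And>m. x m \<in> {a<..<b} - {t} - {s}" and x_lim: "x \<longlonglongrightarrow> s"
    unfolding islimpt_sequential by blast
  have x_cont: "(\<lambda>m. pderiv1 {a..b} j g t' (x m)) \<longlonglongrightarrow> pderiv1 {a..b} j g t' s"
    if "is_green_function a b n k c \<alpha> \<beta> M g" "j \<le> n" "t' \<in> {a..b}" "t' \<noteq> s \<or> Suc j < n" for M g j t'
  proof -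
    have "continuous_on {s' \<in> {a..b}. t' \<noteq> s' \<or> Suc j < n} (\<lambda>s. pderiv1 {a..b} j g t' s)"
      by (rule green_function_continuous_snd[OF \<open>a < b\<close> \<open>k < n\<close> that(1-3)]) auto
    moreover have "eventually (\<lambda>m. x m \<in> {s' \<in> {a..b}. t' \<noteq> s' \<or> Suc j < n}) sequentially"
    proof (cases "Suc j < n")
      case True
      then show ?thesis using x by (auto simp: less_imp_le)
    next
      case False
      then have "eventually (\<lambda>m. x m \<noteq> t') sequentially"
        using that(4) by (intro tendsto_imp_eventually_ne[OF x_lim]) auto
      then show ?thesis
        by eventually_elim (use x in \<open>auto simp: less_imp_le\<close>)
    qed
    ultimately show ?thesis
      by (intro continuous_on_tendsto_compose[OF _ x_lim]) (use that s in auto)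
  qed
  have "k \<le> n" using \<open>k < n\<close> by simp
  obtain C0 where C0: "\<And>r. \<bar>G0 l t r\<bar> \<le> C0"
    using K0.bounded_kernel \<open>l \<le> n\<close> by blast
  obtain C1 where C1: "\<And>r s. \<bar>G1 k r s\<bar> \<le> C1"
    using K1.bounded_kernel \<open>k \<le> n\<close> by blast
  have prod_bd: "\<bar>G0 l t r * G1 k r s'\<bar> \<le> C0 * C1" for r s'
    unfolding abs_mult using C0[of r] C1[of r s'] by (intro mult_mono) (auto intro: order.trans[OF abs_ge_zero])
  \<comment> \<open>The point \<open>r = s\<close> is cut out since \<open>\<partial>\<^sup>k g1\<close> need not be continuous at \<open>(s, s)\<close>.\<close>
  define F where "F m r = (if r = s then 0 else G0 l t r * G1 k r (x m))" for m r
  define H where "H r = (if r = s then 0 else G0 l t r * pderiv1 {a..b} k g1 r s)" for r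
  have F_lim: "(\<lambda>m. integral {a..b} (F m)) \<longlonglongrightarrow> integral {a..b} H"
  proof (rule dominated_convergence(2)[where h = "\<lambda>_. C0 * C1"])
    show "F m integrable_on {a..b}" for m
    proof -
      note [measurable] = K0.section_measurable(1)[OF \<open>l \<le> n\<close>] K1.section_measurable(2)[OF \<open>k \<le> n\<close>]
      have "(\<lambda>r. G0 l t r * G1 k r (x m)) integrable_on {a..b}"
        by (rule bounded_measurable_integrable_on(2)[of _ "C0 * C1"]) (use prod_bd in auto)
      then show ?thesis
        by (rule integrable_spike_finite[of "{s}", rotated 2]) (auto simp: F_def)
    qed
    show "norm (F m r) \<le> C0 * C1" for m r
      using prod_bd[of r "x m"] by (auto simp: F_def intro: order.trans[OF abs_ge_zero])
    show "(\<lambda>m. F m r) \<longlonglongrightarrow> H r" if r: "r \<in> {a..b}" for r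
    proof (cases "r = s")
      case True
      then show ?thesis by (simp add: F_def H_def)
    next
      case False
      have "eventually (\<lambda>m. x m \<noteq> r) sequentially"
        by (rule tendsto_imp_eventually_ne[OF x_lim]) (use False in auto)
      then have "eventually (\<lambda>m. G0 l t r * pderiv1 {a..b} k g1 r (x m) = F m r) sequentially"
        by eventually_elim (use x r False in \<open>auto simp: F_def G1_def off_diagonal_kernel_def\<close>)
      moreover have "(\<lambda>m. G0 l t r * pderiv1 {a..b} k g1 r (x m)) \<longlonglongrightarrow> H r"
        using False unfolding H_def by (auto intro!: tendsto_intros x_cont[OF g1 \<open>k \<le> n\<close> r])
      ultimately show ?thesis by (rule Lim_transform_eventually[rotated])
    qed
  qed auto
  have H_eq: "integral {a..b} H = integral {a..b} (\<lambda>r. pderiv1 {a..b} l g0 t r * pderiv1 {a..b} k g1 r s)"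
    by (rule integral_spike[of "{a, b, s, t}"]) (use t in \<open>auto simp: H_def G0_def off_diagonal_kernel_def\<close>)
  have identity: "pderiv1 {a..b} l g1 t (x m) = pderiv1 {a..b} l g0 t (x m) + (M0 - M1) *
      (integral {a..b} (F m) + (if l = n then pderiv1 {a..b} k g1 t (x m) else 0))" for m
  proof -
    have "G1 l t (x m) = G0 l t (x m) + (M0 - M1) *
        (integral {a..b} (\<lambda>r. G0 l t r * G1 k r (x m)) + (if l = n then G1 k t (x m) else 0))"
      by (rule resolvent_identity[OF K0.green_kernel_axioms K1.green_kernel_axioms c_cont unique])
         (use x t \<open>l \<le> n\<close> in auto)
    moreover have "integral {a..b} (\<lambda>r. G0 l t r * G1 k r (x m)) = integral {a..b} (F m)"
      by (rule integral_spike[of "{s}"]) (auto simp: F_def)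
    moreover have "x m \<in> {a<..<b}" "t \<noteq> x m" using x[of m] by auto
    ultimately show ?thesis
      using t by (simp add: G0_def G1_def off_diagonal_kernel_def)
  qed
  have "(\<lambda>m. pderiv1 {a..b} l g0 t (x m) + (M0 - M1) *
      (integral {a..b} (F m) + (if l = n then pderiv1 {a..b} k g1 t (x m) else 0)))
    \<longlonglongrightarrow> pderiv1 {a..b} l g0 t s + (M0 - M1) *
      (integral {a..b} H + (if l = n then pderiv1 {a..b} k g1 t s else 0))"
  proof -
    have "(\<lambda>m. pderiv1 {a..b} l g0 t (x m)) \<longlonglongrightarrow> pderiv1 {a..b} l g0 t s"
      by (rule x_cont[OF g0 \<open>l \<le> n\<close> t ts])
    moreover have "(\<lambda>m. if l = n then pderiv1 {a..b} k g1 t (x m) else 0)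
        \<longlonglongrightarrow> (if l = n then pderiv1 {a..b} k g1 t s else 0)"
      using x_cont[OF g1 \<open>k \<le> n\<close> t] ts by auto
    ultimately show ?thesis by (intro tendsto_intros F_lim)
  qed
  moreover have "(\<lambda>m. pderiv1 {a..b} l g1 t (x m)) \<longlonglongrightarrow> pderiv1 {a..b} l g1 t s"
    by (rule x_cont[OF g1 \<open>l \<le> n\<close> t ts])
  ultimately show ?thesis
    unfolding identity[symmetric] H_eq by (rule LIMSEQ_unique[rotated])
qed

theorem theorem2p3:
  fixes a b M0 M1 :: real and n k l :: nat
    and c :: "nat \<Rightarrow> real \<Rightarrow> real" and \<alpha> \<beta> :: "nat \<Rightarrow> nat \<Rightarrow> real"
    and g0 g1 :: "real \<Rightarrow> real \<Rightarrow> real"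
  defines "D \<equiv> pderiv1 {a..b}"
  assumes "a < b" and "k < n" and "l < n"
    and "\<And>i. i \<in> {1..n} \<Longrightarrow> continuous_on {a..b} (c i)"
    and "has_unique_solution a b n k c \<alpha> \<beta> M0"
    and "has_unique_solution a b n k c \<alpha> \<beta> M1"
    and "is_green_function a b n k c \<alpha> \<beta> M0 g0"
    and "is_green_function a b n k c \<alpha> \<beta> M1 g1"
  shows
    "(\<forall>t\<in>{a..b}. \<forall>s\<in>{a..b}. (l = n - 1 \<longrightarrow> t \<noteq> s) \<longrightarrow>
        D l g1 t s = D l g0 t s + (M0 - M1) * integral {a..b} (\<lambda>r. D l g0 t r * D k g1 r s)) \<and>
     (\<forall>t\<in>{a..b}. \<forall>s\<in>{a..b}. (l = n - 1 \<longrightarrow> t \<noteq> s) \<longrightarrow>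
        D l g1 t s = D l g0 t s + (M0 - M1) * integral {a..b} (\<lambda>r. D l g1 t r * D k g0 r s)) \<and>
     (\<forall>t\<in>{a..b}. \<forall>s\<in>{a..b}. t \<noteq> s \<longrightarrow>
        D n g1 t s = D n g0 t s + (M0 - M1) * integral {a..b} (\<lambda>r. D n g0 t r * D k g1 r s)
          + (M0 - M1) * D k g1 t s) \<and>
     (\<forall>t\<in>{a..b}. \<forall>s\<in>{a..b}. t \<noteq> s \<longrightarrow>
        D n g1 t s = D n g0 t s + (M0 - M1) * integral {a..b} (\<lambda>r. D n g1 t r * D k g0 r s)
          + (M0 - M1) * D k g0 t s)"
proof -
  note first = green_function_perturbation[OF assms(2,3,5,6,8,9), folded D_def]
  note second = green_function_perturbation[OF assms(2,3,5,7,9,8), folded D_def]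
  have off_or_low: "t \<noteq> s \<or> Suc l < n" if "l = n - 1 \<longrightarrow> t \<noteq> s" for t s :: real
    using that \<open>l < n\<close> by auto
  show ?thesis
  proof (intro conjI ballI impI)
    fix t s assume ts: "t \<in> {a..b}" "s \<in> {a..b}" "l = n - 1 \<longrightarrow> t \<noteq> s"
    show "D l g1 t s = D l g0 t s + (M0 - M1) * integral {a..b} (\<lambda>r. D l g0 t r * D k g1 r s)"
      using first[of l t s] ts off_or_low \<open>l < n\<close> by simp
    show "D l g1 t s = D l g0 t s + (M0 - M1) * integral {a..b} (\<lambda>r. D l g1 t r * D k g0 r s)"
      using second[of l t s] ts off_or_low \<open>l < n\<close> by (simp add: algebra_simps)
  next
    fix t s assume ts: "t \<in> {a..b}" "s \<in> {a..b}" "t \<noteq> s"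
    show "D n g1 t s = D n g0 t s + (M0 - M1) * integral {a..b} (\<lambda>r. D n g0 t r * D k g1 r s)
        + (M0 - M1) * D k g1 t s"
      using first[of n t s] ts by (simp add: algebra_simps)
    show "D n g1 t s = D n g0 t s + (M0 - M1) * integral {a..b} (\<lambda>r. D n g1 t r * D k g0 r s)
        + (M0 - M1) * D k g0 t s"
      using second[of n t s] ts by (simp add: algebra_simps)
  qed
qed

end
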